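(* Let $\mathcal{X}:=\mathbb{R}^{m_1\times n_1}\times\cdots\times\mathbb{R}^{m_J\times n_J}$ and $L_1,\dots,L_J>0$. Let $\{\mathbf A_t\}_{t\ge0}$ be a sequence of random elements of $\mathcal{X}$, $\mathbf A_t=([A_t]_1,\ldots,[A_t]_J)$ with $[A_t]_j\in\mathbb{R}^{m_j\times n_j}$, and let $\mathcal{F}_t:=\sigma(\mathbf A_0,\ldots,\mathbf A_t)$. Assume that $\mathbb{E}[[A_0]_j]=0$ and, for each $t\ge1$, $\mathbb{E}[[A_t]_j\mid\mathcal{F}_{t-1}]=0$ for all $j\in[J]$, and that $\mathbb{E}[[A_t]_j[A_t]_j^T]$ is well-defined (finite) for all $t$ and $j$. For arbitrary $k\ge1$, symmetric positive definite matrices $\Lambda_j\in\mathbb{R}^{m_j\times m_j}$ and $q_j\in[1,2]$, $j\in[J]$, define $B_j\ge0$ by $$B_j^2:=L_j^{-1}\|\Lambda_j\|_{S_{\frac{q_j}{2-q_j}}}\sum_{t=0}^{k-1}\mathrm{Tr}\!\left(\mathbb{E}[[A_t]_j[A_t]_j^T]\Lambda_j^{-1}\right),$$ where $S_{\frac{q_j}{2-q_j}}$ is interpreted as $S_\infty$ when $q_j=2$. Then, for any $\beta\in[1,2]$, $$\mathbb{E}\Big[\Big\|\sum_{t=0}^{k-1}\mathbf A_t\Big\|_{\mathbf v,\mathbf q}^2\Big]\le\|(B_1,\ldots,B_J)\|_\beta^2.$$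
   Context: $[J]=\{1,\dots,J\}$. $\|Z\|_{S_r}$ is the Schatten-$r$ norm (the $\ell_r$ norm of the singular values). The mixed norm, with $\mathbf v=(\beta,L_1^{-1},\dots,L_J^{-1})$ and $\mathbf q=(q_1,\dots,q_J)$, is $$\|\mathbf X\|_{\mathbf v,\mathbf q}:=\big\|\big(L_1^{-1/2}\|[X]_1\|_{S_{q_1}},\dots,L_J^{-1/2}\|[X]_J\|_{S_{q_J}}\big)\big\|_\beta,$$ where $[X]_j$ is the $j$th block of $\mathbf X\in\mathcal{X}$ and $\|\cdot\|_\beta$ is the $\ell_\beta$ norm on $\mathbb{R}^J$. *)

theory Defs
  imports
    "HOL-Probability.Probability"
    "Jordan_Normal_Form.Char_Poly"
    "Jordan_Normal_Form.Gauss_Jordan_Elimination"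
begin

text \<open>The \<open>\<ell>\<^sub>p\<close> norm of a finite family of reals, for \<open>1 \<le> p \<le> \<infinity>\<close>. The empty family has norm \<open>0\<close>.\<close>

definition lp_norm :: "ereal \<Rightarrow> 'i set \<Rightarrow> ('i \<Rightarrow> real) \<Rightarrow> real" where
  "lp_norm p I x =
     (if p = \<infinity> then Max (insert 0 ((\<lambda>i. \<bar>x i\<bar>) ` I))
      else (\<Sum>i\<in>I. \<bar>x i\<bar> powr real_of_ereal p) powr (1 / real_of_ereal p))"

text \<open>The square roots of the eigenvalues of \<open>X\<^sup>T X\<close> (all real and nonnegative), repeated according to
  multiplicity. For an \<open>m \<times> n\<close> matrix with \<open>m < n\<close> the list has \<open>n - m\<close> more zeros than there are singular
  values under the convention that counts \<open>min m n\<close> of them; zeros do not affect the norms below.\<close>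

definition singular_values :: "real mat \<Rightarrow> real list" where
  "singular_values X = map sqrt (sorted_list_of_multiset (proots (char_poly (X\<^sup>T * X))))"

definition schatten_norm :: "ereal \<Rightarrow> real mat \<Rightarrow> real" where
  "schatten_norm r X = lp_norm r {..<length (singular_values X)} (\<lambda>i. singular_values X ! i)"

text \<open>An element of the product space \<open>\<real>\<^bsup>m\<^sub>1\<times>n\<^sub>1\<^esup> \<times> \<cdots> \<times> \<real>\<^bsup>m\<^sub>J\<times>n\<^sub>J\<^esup>\<close> is a family \<open>X\<close> of matrices, of which only the
  blocks \<open>X 1, \<dots>, X J\<close> are used.\<close>

definition mixed_norm ::
  "nat \<Rightarrow> real \<Rightarrow> (nat \<Rightarrow> real) \<Rightarrow> (nat \<Rightarrow> real) \<Rightarrow> (nat \<Rightarrow> real mat) \<Rightarrow> real" where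
  "mixed_norm J \<beta> L q X =
     lp_norm (ereal \<beta>) {1..J} (\<lambda>j. L j powr (- 1 / 2) * schatten_norm (ereal (q j)) (X j))"

definition mat_trace :: "real mat \<Rightarrow> real" where
  "mat_trace X = (\<Sum>i<dim_row X. X $$ (i, i))"

definition sym_pos_def :: "nat \<Rightarrow> real mat \<Rightarrow> bool" where
  "sym_pos_def n X \<longleftrightarrow> X \<in> carrier_mat n n \<and> X\<^sup>T = X \<and>
     (\<forall>v \<in> carrier_vec n. v \<noteq> 0\<^sub>v n \<longrightarrow> scalar_prod v (X *\<^sub>v v) > 0)"

text \<open>Only meaningful for invertible matrices.\<close>

definition mat_inv :: "real mat \<Rightarrow> real mat" where
  "mat_inv X = the (mat_inverse X)"

text \<open>The library has no sum over a set of matrices of fixed dimensions.\<close>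

definition mat_sum :: "nat \<Rightarrow> nat \<Rightarrow> ('i \<Rightarrow> real mat) \<Rightarrow> 'i set \<Rightarrow> real mat" where
  "mat_sum m n X I = mat m n (\<lambda>(r, c). \<Sum>i\<in>I. X i $$ (r, c))"

definition random_mat :: "'a measure \<Rightarrow> nat \<Rightarrow> nat \<Rightarrow> ('a \<Rightarrow> real mat) \<Rightarrow> bool" where
  "random_mat M m n X \<longleftrightarrow> (\<forall>\<omega> \<in> space M. X \<omega> \<in> carrier_mat m n) \<and>
     (\<forall>r<m. \<forall>c<n. (\<lambda>\<omega>. X \<omega> $$ (r, c)) \<in> borel_measurable M)"

definition mat_integrable :: "'a measure \<Rightarrow> nat \<Rightarrow> nat \<Rightarrow> ('a \<Rightarrow> real mat) \<Rightarrow> bool" where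
  "mat_integrable M m n X \<longleftrightarrow> (\<forall>r<m. \<forall>c<n. integrable M (\<lambda>\<omega>. X \<omega> $$ (r, c)))"

definition mat_expectation :: "'a measure \<Rightarrow> nat \<Rightarrow> nat \<Rightarrow> ('a \<Rightarrow> real mat) \<Rightarrow> real mat" where
  "mat_expectation M m n X = mat m n (\<lambda>(r, c). integral\<^sup>L M (\<lambda>\<omega>. X \<omega> $$ (r, c)))"

definition mat_cond_exp ::
  "'a measure \<Rightarrow> 'a measure \<Rightarrow> nat \<Rightarrow> nat \<Rightarrow> ('a \<Rightarrow> real mat) \<Rightarrow> 'a \<Rightarrow> real mat" where
  "mat_cond_exp M F m n X \<omega> = mat m n (\<lambda>(r, c). real_cond_exp M F (\<lambda>\<omega>'. X \<omega>' $$ (r, c)) \<omega>)"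

text \<open>The \<open>\<sigma>\<close>-algebra generated by \<open>A 0, \<dots>, A t\<close>, i.e. by all entries of all their blocks; \<open>A s j \<omega>\<close> is
  block \<open>j\<close> of \<open>A s\<close> at the outcome \<open>\<omega>\<close>.\<close>

definition gen_sigma ::
  "'a measure \<Rightarrow> nat \<Rightarrow> (nat \<Rightarrow> nat) \<Rightarrow> (nat \<Rightarrow> nat) \<Rightarrow> (nat \<Rightarrow> nat \<Rightarrow> 'a \<Rightarrow> real mat) \<Rightarrow> nat \<Rightarrow> 'a measure"
where
  "gen_sigma M J m n A t = sigma (space M)
     {(\<lambda>\<omega>. A s j \<omega> $$ (r, c)) -` S \<inter> space M | s j r c S.
        s \<le> t \<and> j \<in> {1..J} \<and> r < m j \<and> c < n j \<and> S \<in> sets borel}"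

end

theory Submission
  imports Defs
begin

text \<open>
  Every norm below is estimated by the same Hoelder inequality, which trades an \<open>\<ell>\<^sub>q\<close> norm with
  \<open>q < 2\<close> for a weighted sum of squares. In singular bases of \<open>X\<close> (on the right) and eigenbases of \<open>\<Lambda>\<close>
  (on the left), \<open>X\<close> becomes a matrix \<open>D\<close> with orthogonal columns of lengths \<open>\<sigma>\<^sub>i\<close>. The weights
  \<open>D\<^sub>k\<^sub>i\<^sup>2 / \<sigma>\<^sub>i\<^sup>2\<close> sum to \<open>1\<close> over \<open>k\<close> and, by Bessel, to at most \<open>1\<close> over \<open>i\<close>; this gives
  \<open>\<parallel>X\<parallel>\<^sub>q\<^sup>2 \<le> \<parallel>\<Lambda>\<parallel>\<^sub>r Tr (X X\<^sup>T \<Lambda>\<^sup>-\<^sup>1)\<close> with \<open>r = q / (2 - q)\<close>. The right-hand side is quadratic in \<open>X\<close>, so for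
  a sum of martingale differences the cross terms vanish in expectation. The outer \<open>\<ell>\<^sub>\<beta>\<close> norm is
  estimated pointwise in the same way with the deterministic weights \<open>B\<^sub>j\<^bsup>2-\<beta>\<^esup>\<close>, for which Hoelder is sharp
  after taking expectations.
\<close>

section \<open>Weighted Hoelder inequality\<close>

text \<open>Young's inequality is applied to \<open>a i / S\<close> and \<open>b i / T\<close>, with
  S and T the two weighted sums on the right. After weighting by \<open>w\<close> and summing, both
  normalised sums equal 1 and u + v = 1 remains. If S or T vanishes, so does every term on the
  left.\<close>

lemma weighted_Holder_sum:
  fixes w a b :: "'i \<Rightarrow> real"
  assumes fin: "finite I"
    and w: "\<And>i. i \<in> I \<Longrightarrow> 0 \<le> w i" and a: "\<And>i. i \<in> I \<Longrightarrow> 0 \<le> a i" and b: "\<And>i. i \<in> I \<Longrightarrow> 0 \<le> b i"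
    and uv: "0 < u" "0 < v" "u + v = 1"
  shows "(\<Sum>i\<in>I. w i * (a i powr u * b i powr v))
         \<le> (\<Sum>i\<in>I. w i * a i) powr u * (\<Sum>i\<in>I. w i * b i) powr v"
proof -
  define S where "S = (\<Sum>i\<in>I. w i * a i)"
  define T where "T = (\<Sum>i\<in>I. w i * b i)"
  have S0: "0 \<le> S" and T0: "0 \<le> T"
    unfolding S_def T_def using w a b by (auto intro!: sum_nonneg)
  show ?thesis
  proof (cases "S = 0 \<or> T = 0")
    case True
    have "w i * (a i powr u * b i powr v) = 0" if i: "i \<in> I" for i
    proof -
      have "w i * a i = 0 \<or> w i * b i = 0"
        using True unfolding S_def T_def
        by (auto simp: sum_nonneg_eq_0_iff[OF fin] w a b i)
      then show ?thesis by auto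
    qed
    then have "(\<Sum>i\<in>I. w i * (a i powr u * b i powr v)) = 0" by (rule sum.neutral[OF ballI])
    then show ?thesis by (simp flip: S_def T_def)
  next
    case False
    with S0 T0 have S: "0 < S" and T: "0 < T" by auto
    have "w i * (a i powr u * b i powr v)
          \<le> S powr u * T powr v * (u / S * (w i * a i) + v / T * (w i * b i))" if i: "i \<in> I" for i
    proof -
      have "(a i / S) powr u * (b i / T) powr v \<le> u * (a i / S) + v * (b i / T)"
      proof (cases "a i = 0 \<or> b i = 0")
        case True
        then show ?thesis using a[OF i] b[OF i] S T uv by auto
      next
        case False
        then show ?thesis
          using Youngs_inequality_0[of u v "a i / S" "b i / T"] a[OF i] b[OF i] S T uv
          by (simp add: less_le)
      qed
      then have "a i powr u * b i powr v \<le> S powr u * T powr v * (u * (a i / S) + v * (b i / T))"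
        using S T a[OF i] b[OF i] by (simp add: powr_divide divide_simps mult_ac)
      from mult_left_mono[OF this w[OF i]] show ?thesis by (simp add: algebra_simps)
    qed
    then have "(\<Sum>i\<in>I. w i * (a i powr u * b i powr v))
               \<le> (\<Sum>i\<in>I. S powr u * T powr v * (u / S * (w i * a i) + v / T * (w i * b i)))"
      by (rule sum_mono)
    also have "\<dots> = S powr u * T powr v * (u / S * S + v / T * T)"
      unfolding S_def T_def
      by (simp only: sum.distrib sum_distrib_left[symmetric])
    also have "\<dots> = S powr u * T powr v" using S T uv by simp
    finally show ?thesis unfolding S_def T_def .
  qed
qed

text \<open>Hoelder with the exponents 2 / (2 - q) and 2 / q, after splitting x^q into
  (l^(q/(2-q)))^((2-q)/2) and (x^2/l)^(q/2). The extra weights \<open>c\<close> serve the matrix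
  case; the outer norm takes them equal to 1.\<close>

lemma sum_powr_le_weighted:
  fixes c x l :: "'i \<Rightarrow> real"
  assumes fin: "finite I"
    and c: "\<And>i. i \<in> I \<Longrightarrow> 0 \<le> c i" and x: "\<And>i. i \<in> I \<Longrightarrow> 0 \<le> x i" and l: "\<And>i. i \<in> I \<Longrightarrow> 0 < l i"
    and q: "0 < q" "q < 2"
  shows "(\<Sum>i\<in>I. c i * x i powr q)
         \<le> (\<Sum>i\<in>I. c i * l i powr (q / (2 - q))) powr ((2 - q) / 2)
           * (\<Sum>i\<in>I. c i * ((x i)\<^sup>2 / l i)) powr (q / 2)"
proof -
  have "x i powr q = (l i powr (q / (2 - q))) powr ((2 - q) / 2) * ((x i)\<^sup>2 / l i) powr (q / 2)"
    if "i \<in> I" for i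
  proof -
    have "((x i)\<^sup>2) powr (q / 2) = x i powr q"
      using x[OF that] q by (cases "x i = 0") (simp_all add: powr_powr flip: powr_numeral)
    then show ?thesis
      using x[OF that] l[OF that] q by (simp add: powr_powr powr_divide)
  qed
  then have "(\<Sum>i\<in>I. c i * x i powr q)
      = (\<Sum>i\<in>I. c i * ((l i powr (q / (2 - q))) powr ((2 - q) / 2) * ((x i)\<^sup>2 / l i) powr (q / 2)))"
    by simp
  also have "\<dots> \<le> (\<Sum>i\<in>I. c i * l i powr (q / (2 - q))) powr ((2 - q) / 2)
           * (\<Sum>i\<in>I. c i * ((x i)\<^sup>2 / l i)) powr (q / 2)"
    using q by (intro weighted_Holder_sum fin c) (auto simp: l less_imp_le field_simps)
  finally show ?thesis .
qed

text \<open>Passes from power sums to squared norms by raising to the power 2 / q. If S and P are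
  power sums for the exponents q and q / (2 - q), the conclusion bounds a squared q-norm by a q / (2
  - q)-norm times T.\<close>

lemma square_powr_inverse_le:
  fixes S T P q :: real
  assumes "S \<le> P powr ((2 - q) / 2) * T powr (q / 2)" and "0 \<le> S" "0 \<le> T" and q: "0 < q"
  shows "(S powr (1 / q))\<^sup>2 \<le> P powr ((2 - q) / q) * T"
proof -
  have "(S powr (1 / q))\<^sup>2 = S powr (2 / q)"
    by (simp add: power2_eq_square flip: powr_add)
  also have "\<dots> \<le> (P powr ((2 - q) / 2) * T powr (q / 2)) powr (2 / q)"
    using assms by (intro powr_mono2) auto
  also have "\<dots> = P powr ((2 - q) / 2 * (2 / q)) * T powr (q / 2 * (2 / q))"
    by (subst powr_mult) (simp_all only: powr_powr powr_ge_zero)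
  also have "(2 - q) / 2 * (2 / q) = (2 - q) / q" using q by (auto simp: field_simps)
  also have "q / 2 * (2 / q) = 1" using q by simp
  finally show ?thesis using assms by simp
qed

section \<open>Diagonalization of symmetric real matrices\<close>

lemma index_mult_mat_sum:
  fixes A B :: "'a :: semiring_0 mat"
  assumes "A \<in> carrier_mat nr n" "B \<in> carrier_mat n nc" "i < nr" "j < nc"
  shows "(A * B) $$ (i, j) = (\<Sum>k<n. A $$ (i, k) * B $$ (k, j))"
  using assms by (auto simp: scalar_prod_def atLeast0LessThan intro!: sum.cong)

text \<open>Over the complex numbers an eigenvector w = x + iy exists. Once its eigenvalue is known
  to be real, each of x and y is zero or a real eigenvector, and a nonzero one is
  normalised.\<close>

lemma symmetric_real_mat_eigenvector:
  fixes A :: "real mat"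
  assumes A: "A \<in> carrier_mat n n" and sym: "A\<^sup>T = A" and n: "0 < n"
  obtains e v where "(\<Sum>i<n. (v i)\<^sup>2) = 1" "\<And>i. i < n \<Longrightarrow> (\<Sum>j<n. A $$ (i, j) * v j) = e * v i"
proof -
  define C where "C = map_mat complex_of_real A"
  have C: "C \<in> carrier_mat n n" using A by (simp add: C_def)
  have "degree (char_poly C) = n" using degree_monic_char_poly[OF C] by simp
  then have "\<not> constant (poly (char_poly C))" using n by (simp add: constant_degree)
  then obtain z where "poly (char_poly C) z = 0" using fundamental_theorem_of_algebra by blast
  then obtain w where "eigenvector C w z"
    using eigenvalue_root_char_poly[OF C] unfolding eigenvalue_def by blast
  then have w: "w \<in> carrier_vec n" "w \<noteq> 0\<^sub>v n" and Cw: "C *\<^sub>v w = z \<cdot>\<^sub>v w"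
    using C unfolding eigenvector_def by auto
  define x where "x i = Re (vec_index w i)" for i
  define y where "y i = Im (vec_index w i)" for i
  have ev: "(\<Sum>j<n. complex_of_real (A $$ (i, j)) * vec_index w j) = z * vec_index w i" if i: "i < n" for i
  proof -
    have "vec_index (C *\<^sub>v w) i = (\<Sum>j<n. complex_of_real (A $$ (i, j)) * vec_index w j)"
      using i A w by (auto simp: C_def scalar_prod_def atLeast0LessThan intro!: sum.cong)
    then show ?thesis using i w by (simp add: Cw)
  qed
  have Ax: "(\<Sum>j<n. A $$ (i, j) * x j) = Re z * x i - Im z * y i" if "i < n" for i
    using arg_cong[OF ev[OF that], of Re] by (simp add: x_def y_def)
  have Ay: "(\<Sum>j<n. A $$ (i, j) * y j) = Im z * x i + Re z * y i" if "i < n" for i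
    using arg_cong[OF ev[OF that], of Im] by (simp add: x_def y_def)
  have symij: "A $$ (i, j) = A $$ (j, i)" if "i < n" "j < n" for i j
    using that A index_transpose_mat(1)[of i A j] by (simp add: sym)
  \<comment> \<open>Symmetry forces the complex eigenvalue \<open>z\<close> to be real.\<close>
  have "(\<Sum>i<n. x i * (\<Sum>j<n. A $$ (i, j) * y j)) = (\<Sum>i<n. y i * (\<Sum>j<n. A $$ (i, j) * x j))"
    unfolding sum_distrib_left
    by (subst sum.swap) (auto intro!: sum.cong simp: symij)
  then have "(\<Sum>i<n. x i * (Im z * x i + Re z * y i)) = (\<Sum>i<n. y i * (Re z * x i - Im z * y i))"
    by (simp add: Ax Ay)
  then have "Im z * ((\<Sum>i<n. (x i)\<^sup>2) + (\<Sum>i<n. (y i)\<^sup>2)) = 0"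
    by (simp add: algebra_simps sum.distrib sum_subtractf sum_distrib_left power2_eq_square)
  moreover obtain i0 where i0: "i0 < n" "vec_index w i0 \<noteq> 0"
    using w by (metis carrier_vecD eq_vecI index_zero_vec(1) index_zero_vec(2))
  then have xy: "x i0 \<noteq> 0 \<or> y i0 \<noteq> 0" by (auto simp: x_def y_def complex_eq_iff)
  moreover have ge: "(f i0)\<^sup>2 \<le> (\<Sum>i<n. (f i)\<^sup>2)" for f :: "nat \<Rightarrow> real"
    using i0 by (intro member_le_sum) auto
  have "0 < (\<Sum>i<n. (x i)\<^sup>2) + (\<Sum>i<n. (y i)\<^sup>2)"
    using xy ge[of x] ge[of y] sum_power2_gt_zero_iff[of "x i0" "y i0"] by linarith
  ultimately have z: "Im z = 0" by simp
  note witness = that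
  have main: thesis if u: "u i0 \<noteq> 0" and Au: "\<And>i. i < n \<Longrightarrow> (\<Sum>j<n. A $$ (i, j) * u j) = Re z * u i" for u
  proof -
    define s where "s = sqrt (\<Sum>i<n. (u i)\<^sup>2)"
    have pos: "0 < (\<Sum>i<n. (u i)\<^sup>2)" using ge[of u] u by (smt (verit) zero_less_power2)
    then have s: "0 < s" "s\<^sup>2 = (\<Sum>i<n. (u i)\<^sup>2)" by (auto simp: s_def)
    show thesis
    proof (rule witness[of "\<lambda>i. u i / s" "Re z"])
      show "(\<Sum>i<n. (u i / s)\<^sup>2) = 1"
        using s pos by (simp add: power_divide flip: sum_divide_distrib)
      show "(\<Sum>j<n. A $$ (i, j) * (u j / s)) = Re z * (u i / s)" if "i < n" for i
        using Au[OF that] by (simp flip: sum_divide_distrib)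
    qed
  qed
  from xy show thesis
    using main[of x] main[of y] Ax Ay z by auto
qed

text \<open>The Householder reflection I - 2 w w^T / |w|^2 with w = v - e_0 exchanges v and the unit
  vector e_0. It serves to split off an eigenvector v.\<close>

lemma householder_mat:
  fixes v :: "nat \<Rightarrow> real"
  assumes v: "(\<Sum>i<Suc n. (v i)\<^sup>2) = 1"
  obtains H where "H \<in> carrier_mat (Suc n) (Suc n)" "H\<^sup>T = H" "H * H = 1\<^sub>m (Suc n)"
    "\<And>i. i < Suc n \<Longrightarrow> H $$ (i, 0) = v i"
proof -
  define N where "N = Suc n"
  define \<delta> :: "nat \<Rightarrow> nat \<Rightarrow> real" where "\<delta> i j = (if i = j then 1 else 0)" for i j
  \<comment> \<open>If \<open>v\<close> is the \<open>0\<close>-th unit vector, then \<open>s = 0\<close>, hence \<open>c = 2 / 0 = 0\<close> and \<open>H\<close> is the identity.\<close>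
  define w where "w i = v i - \<delta> i 0" for i
  define s where "s = (\<Sum>i<N. (w i)\<^sup>2)"
  define c where "c = 2 / s"
  define H where "H = mat N N (\<lambda>(i, j). \<delta> i j - c * w i * w j)"
  have \<delta>l: "(\<Sum>k<N. \<delta> i k * f k) = f i" "(\<Sum>k<N. \<delta> k i * f k) = f i" if "i < N" for i f
    using that by (simp_all add: \<delta>_def if_distrib[of "\<lambda>x. x * _"] cong: if_cong)
  have s_eq: "s = 2 - 2 * v 0"
  proof -
    have "s = (\<Sum>i<N. (v i)\<^sup>2 - 2 * (\<delta> i 0 * v i) + \<delta> i 0 * 1)"
      unfolding s_def w_def by (intro sum.cong) (auto simp: \<delta>_def power2_diff)
    also have "\<dots> = 1 - 2 * v 0 + 1"
      unfolding sum.distrib sum_subtractf sum_distrib_left[symmetric]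
      using v by (subst \<delta>l, simp add: N_def)+ (simp add: N_def)
    finally show ?thesis by simp
  qed
  have sw: "w i = 0" if "s = 0" "i < N" for i
    using that unfolding s_def by (auto simp: sum_nonneg_eq_0_iff)
  have H0: "H $$ (i, 0) = v i" if i: "i < N" for i
  proof (cases "s = 0")
    case True
    then have "w i = 0" using sw i by simp
    then show ?thesis using i by (simp add: H_def N_def w_def)
  next
    case False
    \<comment> \<open>Because |v| = 1, the entry w_0 = v_0 - 1 equals - s / 2.\<close>
    have "c * w 0 = -1" using False by (simp add: c_def w_def \<delta>_def s_eq divide_simps)
    moreover have "c * w i * w 0 = (c * w 0) * w i" by simp
    ultimately have "c * w i * w 0 = - w i" by simp
    then show ?thesis using i by (simp add: H_def N_def w_def)
  qed
  have HH: "(\<Sum>k<N. H $$ (i, k) * H $$ (k, j)) = \<delta> i j" if ij: "i < N" "j < N" for i j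
  proof -
    have "(\<Sum>k<N. H $$ (i, k) * H $$ (k, j))
        = (\<Sum>k<N. \<delta> i k * \<delta> k j - \<delta> i k * (c * w k * w j) - \<delta> k j * (c * w i * w k)
              + c * c * w i * w j * (w k)\<^sup>2)"
      using ij by (intro sum.cong) (auto simp: H_def algebra_simps power2_eq_square)
    also have "\<dots> = \<delta> i j - 2 * c * w i * w j + c * c * w i * w j * s"
      using ij by (simp add: sum.distrib sum_subtractf \<delta>l s_def flip: sum_distrib_left)
    also have "\<dots> = \<delta> i j + c * w i * w j * (c * s - 2)"
      by (simp add: algebra_simps)
    \<comment> \<open>Here c s = 2 unless s = 0, and in that case w vanishes.\<close>
    also have "\<dots> = \<delta> i j" using sw ij by (cases "s = 0") (auto simp: c_def)
    finally show ?thesis .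
  qed
  have H: "H \<in> carrier_mat N N" by (simp add: H_def)
  show thesis
  proof (rule that[folded N_def])
    show "H \<in> carrier_mat N N" by (rule H)
    show "H\<^sup>T = H" by (rule eq_matI) (auto simp: H_def \<delta>_def)
    show "H * H = 1\<^sub>m N"
    proof (rule eq_matI)
      fix i j assume "i < dim_row (1\<^sub>m N)" "j < dim_col (1\<^sub>m N)"
      then have ij: "i < N" "j < N" by auto
      show "(H * H) $$ (i, j) = 1\<^sub>m N $$ (i, j)"
        unfolding index_mult_mat_sum[OF H H ij] HH[OF ij] using ij by (simp add: \<delta>_def)
    qed (use H in auto)
  qed (use H0 in auto)
qed

text \<open>The premises compare inner dimensions only. With dimension equations such as
  \<open>dims\<close> they reduce to identities, so that any product can be brought to right-nested
  form.\<close>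

lemma mult_mat_assoc:
  fixes A B C :: "'a :: semiring_0 mat"
  assumes "dim_col A = dim_row B" "dim_col B = dim_row C"
  shows "(A * B) * C = A * (B * C)"
  using assms by (intro assoc_mult_mat[of _ "dim_row A" "dim_col A" _ "dim_col B" _ "dim_col C"]) auto

lemma dim_mat_diag [simp]: "dim_row (mat_diag n f) = n" "dim_col (mat_diag n f) = n"
  by (simp_all add: mat_diag_def)

text \<open>Induction by deflation. Conjugation with a reflection H whose first column is an
  eigenvector makes A block diagonal with a leading 1 x 1 block; the induction hypothesis
  diagonalises the remaining block.\<close>

lemma symmetric_real_mat_diagonalization:
  fixes A :: "real mat"
  assumes "A \<in> carrier_mat n n" "A\<^sup>T = A"
  shows "\<exists>U d. U \<in> carrier_mat n n \<and> U\<^sup>T * U = 1\<^sub>m n \<and> A = U * mat_diag n d * U\<^sup>T"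
  using assms
proof (induction n arbitrary: A)
  case 0
  then show ?case
    by (intro exI[of _ "1\<^sub>m 0"] exI[of _ "\<lambda>_. 0"]) (auto intro!: eq_matI)
next
  case (Suc n)
  note A = Suc.prems(1) and sym = Suc.prems(2)
  let ?N = "Suc n"
  obtain v e where v: "(\<Sum>i<?N. (v i)\<^sup>2) = 1"
    and ev: "\<And>i. i < ?N \<Longrightarrow> (\<Sum>j<?N. A $$ (i, j) * v j) = e * v i"
    using symmetric_real_mat_eigenvector[OF A sym] by (metis zero_less_Suc)
  obtain H where H: "H \<in> carrier_mat ?N ?N" and HT: "H\<^sup>T = H" and HH: "H * H = 1\<^sub>m ?N"
    and H0: "\<And>i. i < ?N \<Longrightarrow> H $$ (i, 0) = v i"
    using householder_mat[OF v] by metis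
  define R where "R = H * A * H"
  note dims = carrier_matD[OF A] carrier_matD[OF H]
  have R: "R \<in> carrier_mat ?N ?N" using A H by (simp add: R_def)
  have RT: "R\<^sup>T = R"
    unfolding R_def using A H
    by (simp add: transpose_mult[of _ ?N ?N _ ?N] HT sym dims mult_mat_assoc)
  \<comment> \<open>With v = H e_0 this reads R e_0 = H A v = e H v = e H H e_0 = e e_0.\<close>
  have R0: "R $$ (i, 0) = (if i = 0 then e else 0)" if i: "i < ?N" for i
  proof -
    have AH: "A * H \<in> carrier_mat ?N ?N" using A H by simp
    have "R $$ (i, 0) = (H * (A * H)) $$ (i, 0)"
      using A H by (simp add: R_def dims mult_mat_assoc)
    also have "\<dots> = (\<Sum>k<?N. H $$ (i, k) * (A * H) $$ (k, 0))"
      using index_mult_mat_sum[OF H AH i] by simp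
    also have "\<dots> = (\<Sum>k<?N. H $$ (i, k) * (e * v k))"
    proof (rule sum.cong[OF refl])
      fix k assume "k \<in> {..<?N}"
      then have k: "k < ?N" by simp
      have "(A * H) $$ (k, 0) = (\<Sum>j<?N. A $$ (k, j) * H $$ (j, 0))"
        using index_mult_mat_sum[OF A H k] by simp
      also have "\<dots> = (\<Sum>j<?N. A $$ (k, j) * v j)"
        by (intro sum.cong) (auto simp: H0)
      also have "\<dots> = e * v k" by (rule ev[OF k])
      finally show "H $$ (i, k) * (A * H) $$ (k, 0) = H $$ (i, k) * (e * v k)" by simp
    qed
    also have "\<dots> = e * (\<Sum>k<?N. H $$ (i, k) * H $$ (k, 0))"
      unfolding sum_distrib_left by (intro sum.cong) (auto simp: H0)
    also have "\<dots> = e * (H * H) $$ (i, 0)"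
      using index_mult_mat_sum[OF H H i] by simp
    also have "\<dots> = (if i = 0 then e else 0)" using i by (simp add: HH)
    finally show ?thesis .
  qed
  have Rsym: "R $$ (i, j) = R $$ (j, i)" if "i < ?N" "j < ?N" for i j
    using that R index_transpose_mat(1)[of i R j] by (simp add: RT)
  define A' where "A' = mat n n (\<lambda>(i, j). R $$ (Suc i, Suc j))"
  have A': "A' \<in> carrier_mat n n" by (simp add: A'_def)
  have "A'\<^sup>T = A'" by (rule eq_matI) (auto simp: A'_def Rsym)
  from Suc.IH[OF A' this] obtain U' d' where U': "U' \<in> carrier_mat n n"
    and UU': "U'\<^sup>T * U' = 1\<^sub>m n" and AU': "A' = U' * mat_diag n d' * U'\<^sup>T" by blast
  \<comment> \<open>K fixes e_0 and lets \<open>U'\<close> act on the other n coordinates, so that K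
    diagonalises R and H K diagonalises A.\<close>
  define K where "K = four_block_mat (1\<^sub>m 1) (0\<^sub>m 1 n) (0\<^sub>m n 1) U'"
  define d where "d i = (case i of 0 \<Rightarrow> e | Suc i \<Rightarrow> d' i)" for i
  have K: "K \<in> carrier_mat ?N ?N" unfolding K_def using four_block_carrier_mat[OF one_carrier_mat[of 1] U'] by simp
  have KT: "K\<^sup>T = four_block_mat (1\<^sub>m 1) (0\<^sub>m 1 n) (0\<^sub>m n 1) U'\<^sup>T"
    unfolding K_def using U' by (subst transpose_four_block_mat[of _ 1 1 _ n _ n]) simp_all
  have KK: "K\<^sup>T * K = 1\<^sub>m ?N"
  proof -
    have "K\<^sup>T * K = four_block_mat (1\<^sub>m 1) (0\<^sub>m 1 n) (0\<^sub>m n 1) (1\<^sub>m n)"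
      unfolding KT unfolding K_def using U'
      by (subst mult_four_block_mat[of _ 1 1 _ n _ n _ _ 1 _ n]) (simp_all add: UU')
    also have "\<dots> = 1\<^sub>m ?N" by (rule eq_matI) auto
    finally show ?thesis .
  qed
  have D: "mat_diag ?N d = four_block_mat (e \<cdot>\<^sub>m 1\<^sub>m 1) (0\<^sub>m 1 n) (0\<^sub>m n 1) (mat_diag n d')"
    by (rule eq_matI) (auto simp: mat_diag_def d_def split: nat.split)
  have KDK: "K * mat_diag ?N d * K\<^sup>T = R"
  proof -
    have "K * mat_diag ?N d = four_block_mat (e \<cdot>\<^sub>m 1\<^sub>m 1) (0\<^sub>m 1 n) (0\<^sub>m n 1) (U' * mat_diag n d')"
      unfolding D unfolding K_def using U'
      by (subst mult_four_block_mat[of _ 1 1 _ n _ n _ _ 1 _ n]) (simp_all add: left_mult_zero_mat[OF mat_diag_dim])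
    then have "K * mat_diag ?N d * K\<^sup>T = four_block_mat (e \<cdot>\<^sub>m 1\<^sub>m 1) (0\<^sub>m 1 n) (0\<^sub>m n 1) A'"
      unfolding KT using U' A'
      by (simp only:, subst mult_four_block_mat[of _ 1 1 _ n _ n _ _ 1 _ n]) (simp_all add: AU' right_mult_zero_mat[of "U' * mat_diag n d'" n n])
    also have "\<dots> = R"
    proof (rule eq_matI)
      fix i j assume "i < dim_row R" "j < dim_col R"
      then have ij: "i < ?N" "j < ?N" using R by auto
      \<comment> \<open>Column 0 is known from \<open>R0\<close>; row 0 follows by symmetry of
        R.\<close>
      show "four_block_mat (e \<cdot>\<^sub>m 1\<^sub>m 1) (0\<^sub>m 1 n) (0\<^sub>m n 1) A' $$ (i, j) = R $$ (i, j)"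
        using ij A' R0[of i] R0[of j] Rsym[of i j]
        by (cases i; cases j) (auto simp: A'_def)
    qed (use R A' in auto)
    finally show ?thesis .
  qed
  note dims = dims carrier_matD[OF K]
  have HRH: "H * R * H = A"
  proof -
    have "H * R * H = H * (H * A * H) * H" by (simp add: R_def)
    also have "\<dots> = (H * H) * A * (H * H)"
      using A H by (simp add: dims mult_mat_assoc)
    finally show ?thesis using A by (simp add: HH)
  qed
  show ?case
  proof (intro exI conjI)
    show "H * K \<in> carrier_mat ?N ?N" using H K by simp
    have HKT: "(H * K)\<^sup>T = K\<^sup>T * H" using transpose_mult[OF H K] by (simp add: HT)
    have "(H * K)\<^sup>T * (H * K) = K\<^sup>T * (H * H) * K"
      unfolding HKT using H K by (simp add: dims mult_mat_assoc)
    then show "(H * K)\<^sup>T * (H * K) = 1\<^sub>m ?N" using K KK by (simp add: HH)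
    have "H * K * mat_diag ?N d * (H * K)\<^sup>T = H * (K * mat_diag ?N d * K\<^sup>T) * H"
      unfolding HKT by (simp add: dims mult_mat_assoc)
    then show "A = H * K * mat_diag ?N d * (H * K)\<^sup>T" by (simp add: KDK HRH)
  qed
qed

section \<open>Schatten norms\<close>

text \<open>The carrier premises of this rule mention dimensions that matching does not determine; the simplifier
  can search very long for them.\<close>

declare assoc_mult_mat [simp del]

text \<open>Similar matrices share their characteristic polynomial, here the product of the factors
  t - d_i, whose roots with multiplicity are the d_i. Multisets are compared because
  \<open>singular_values\<close> sorts its list while \<open>d\<close> comes in any order.\<close>

lemma mset_singular_values:
  assumes X: "X \<in> carrier_mat m n" and U: "U \<in> carrier_mat n n" "U\<^sup>T * U = 1\<^sub>m n"
    and XX: "X\<^sup>T * X = U * mat_diag n d * U\<^sup>T"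
  shows "mset (singular_values X) = image_mset (\<lambda>i. sqrt (d i)) (mset_set {..<n})"
proof -
  have UU: "U * U\<^sup>T = 1\<^sub>m n"
    using mat_mult_left_right_inverse[of "U\<^sup>T" n U] U by simp
  have "similar_mat (X\<^sup>T * X) (mat_diag n d)"
    by (rule similar_matI[of _ _ U "U\<^sup>T" n]) (use U UU X XX in auto)
  then have "char_poly (X\<^sup>T * X) = char_poly (mat_diag n d)" by (rule char_poly_similar)
  also have "\<dots> = (\<Prod>a\<leftarrow>diag_mat (mat_diag n d). [:- a, 1:])"
    by (rule char_poly_upper_triangular[of _ n]) (auto simp: mat_diag_def upper_triangular_def)
  also have "diag_mat (mat_diag n d) = map d [0..<n]"
    by (auto simp: diag_mat_def mat_diag_def)
  finally have "proots (char_poly (X\<^sup>T * X)) = proots (\<Prod>i\<leftarrow>[0..<n]. [:- d i, 1:])"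
    by (simp add: o_def)
  also have "proots (\<Prod>i\<leftarrow>xs. [:- d i, 1:]) = image_mset d (mset xs)" for xs
  proof (induction xs)
    case (Cons i xs)
    have "(\<Prod>i\<leftarrow>xs. [:- d i, 1:]) \<noteq> 0" by (auto simp: prod_list_zero_iff)
    then show ?case using Cons by (simp add: proots_mult del: mult_pCons_left)
  qed simp
  also have "mset [0..<n] = mset_set {..<n}" by (simp add: atLeast0LessThan)
  finally have "mset (sorted_list_of_multiset (proots (char_poly (X\<^sup>T * X))))
      = image_mset d (mset_set {..<n})"
    by simp
  then show ?thesis
    by (simp add: singular_values_def multiset.map_comp o_def)
qed

text \<open>The norm of a list depends only on the multiset of its entries, so Schatten norms can be
  read off an unsorted diagonal.\<close>

lemma lp_norm_nth:
  "lp_norm (ereal p) {..<length xs} (\<lambda>i. xs ! i)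
   = (\<Sum>x\<in>#mset xs. \<bar>x\<bar> powr p) powr (1 / p)"
proof -
  have "(\<Sum>i<length xs. \<bar>xs ! i\<bar> powr p) = (\<Sum>x\<leftarrow>xs. \<bar>x\<bar> powr p)"
    by (simp add: sum_list_sum_nth atLeast0LessThan)
  then show ?thesis by (simp add: lp_norm_def flip: sum_mset_sum_list)
qed

lemma lp_norm_infinity_nth:
  "lp_norm \<infinity> {..<length xs} (\<lambda>i. xs ! i) = Max (insert 0 (abs ` set_mset (mset xs)))"
proof -
  have "(\<lambda>i. \<bar>xs ! i\<bar>) ` {..<length xs} = abs ` set xs"
    by (force simp: set_conv_nth)
  then show ?thesis by (simp add: lp_norm_def)
qed

context
  fixes X U :: "real mat" and d :: "nat \<Rightarrow> real" and m n :: nat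
  assumes X: "X \<in> carrier_mat m n" and U: "U \<in> carrier_mat n n" "U\<^sup>T * U = 1\<^sub>m n"
    and XX: "X\<^sup>T * X = U * mat_diag n d * U\<^sup>T" and d: "\<And>i. i < n \<Longrightarrow> 0 \<le> d i"
begin

lemma schatten_norm_diagonalized:
  "schatten_norm (ereal p) X = (\<Sum>i<n. sqrt (d i) powr p) powr (1 / p)"
proof -
  have "(\<Sum>i<n. \<bar>sqrt (d i)\<bar> powr p) = (\<Sum>i<n. sqrt (d i) powr p)"
    by (intro sum.cong) (auto simp: d)
  then show ?thesis
    unfolding schatten_norm_def lp_norm_nth mset_singular_values[OF X U XX]
    by (simp add: multiset.map_comp o_def sum_unfold_sum_mset[symmetric])
qed

lemma schatten_norm_infinity_diagonalized:
  "schatten_norm \<infinity> X = Max (insert 0 ((\<lambda>i. sqrt (d i)) ` {..<n}))"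
proof -
  have "abs ` (\<lambda>i. sqrt (d i)) ` {..<n} = (\<lambda>i. sqrt (d i)) ` {..<n}"
    using d by (force simp: image_image)
  then show ?thesis
    unfolding schatten_norm_def lp_norm_infinity_nth mset_singular_values[OF X U XX] by simp
qed

end

lemma schatten_norm_nonneg: "0 \<le> schatten_norm r X"
  by (auto simp: schatten_norm_def lp_norm_def intro!: Max_ge)

section \<open>Positive definite matrices and the trace bound for Schatten norms\<close>

lemma mat_trace_comm:
  assumes "A \<in> carrier_mat m n" "B \<in> carrier_mat n m"
  shows "mat_trace (A * B) = mat_trace (B * A)"
proof -
  have "mat_trace (A * B) = (\<Sum>i<m. \<Sum>k<n. A $$ (i, k) * B $$ (k, i))"
    unfolding mat_trace_def using assms by (auto intro!: sum.cong index_mult_mat_sum simp del: index_mult_mat(1))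
  also have "\<dots> = (\<Sum>k<n. \<Sum>i<m. B $$ (k, i) * A $$ (i, k))"
    by (subst sum.swap) (simp add: mult.commute)
  also have "\<dots> = mat_trace (B * A)"
    unfolding mat_trace_def using assms by (auto intro!: sum.cong index_mult_mat_sum[symmetric] simp del: index_mult_mat(1))
  finally show ?thesis .
qed

text \<open>The eigenvalue \<open>l i\<close> is the value of the quadratic form at the i-th column
  of V, hence positive. The reciprocals on the diagonal then give the inverse in the same
  basis.\<close>

lemma sym_pos_def_diagonalization:
  assumes L: "sym_pos_def m \<Lambda>"
  obtains V l where "V \<in> carrier_mat m m" "V\<^sup>T * V = 1\<^sub>m m" "\<Lambda> = V * mat_diag m l * V\<^sup>T"
    "\<And>i. i < m \<Longrightarrow> 0 < l i" "mat_inv \<Lambda> = V * mat_diag m (\<lambda>i. 1 / l i) * V\<^sup>T"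
proof -
  have c: "\<Lambda> \<in> carrier_mat m m" and sym: "\<Lambda>\<^sup>T = \<Lambda>"
    and pos: "\<And>v. v \<in> carrier_vec m \<Longrightarrow> v \<noteq> 0\<^sub>v m \<Longrightarrow> 0 < scalar_prod v (\<Lambda> *\<^sub>v v)"
    using L by (auto simp: sym_pos_def_def)
  obtain V l where V: "V \<in> carrier_mat m m" and VV: "V\<^sup>T * V = 1\<^sub>m m"
    and eq: "\<Lambda> = V * mat_diag m l * V\<^sup>T"
    using symmetric_real_mat_diagonalization[OF c sym] by blast
  have VV': "V * V\<^sup>T = 1\<^sub>m m" using mat_mult_left_right_inverse[of "V\<^sup>T" m V] V VV by simp
  note dims = carrier_matD[OF V]
  have mid: "V * mat_diag m f * V\<^sup>T * (V * mat_diag m g * V\<^sup>T) = V * mat_diag m (\<lambda>i. f i * g i) * V\<^sup>T"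
    for f g
  proof -
    have "V * mat_diag m f * V\<^sup>T * (V * mat_diag m g * V\<^sup>T)
        = V * mat_diag m f * (V\<^sup>T * V) * mat_diag m g * V\<^sup>T"
      by (simp add: dims mult_mat_assoc)
    also have "\<dots> = V * (mat_diag m f * mat_diag m g) * V\<^sup>T"
      using V by (simp add: VV dims mult_mat_assoc del: mat_diag_diag)
    finally show ?thesis by simp
  qed
  have l: "0 < l i" if i: "i < m" for i
  proof -
    have LV: "\<Lambda> * V = V * mat_diag m l"
      unfolding eq using V by (simp add: VV dims mult_mat_assoc)
    have "scalar_prod (col V i) (\<Lambda> *\<^sub>v col V i) = (V\<^sup>T * (\<Lambda> * V)) $$ (i, i)"
      using V c i by (simp add: col_mult2[OF c V i])
    also have "V\<^sup>T * (\<Lambda> * V) = mat_diag m l"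
    proof -
      have "V\<^sup>T * (V * mat_diag m l) = (V\<^sup>T * V) * mat_diag m l" by (simp add: dims mult_mat_assoc)
      then show ?thesis unfolding LV by (simp add: VV)
    qed
    finally have "scalar_prod (col V i) (\<Lambda> *\<^sub>v col V i) = l i"
      using i by (simp add: mat_diag_def)
    moreover have "col V i \<noteq> 0\<^sub>v m"
    proof
      assume "col V i = 0\<^sub>v m"
      then have "(V\<^sup>T * V) $$ (i, i) = 0" using V i by simp
      then show False using i by (simp add: VV)
    qed
    ultimately show ?thesis using pos[of "col V i"] V i by auto
  qed
  define W where "W = V * mat_diag m (\<lambda>i. 1 / l i) * V\<^sup>T"
  have W: "W \<in> carrier_mat m m" unfolding W_def by (rule carrier_matI) (simp_all add: dims)
  have "mat_diag m (\<lambda>i. l i * (1 / l i)) = 1\<^sub>m m"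
    by (rule eq_matI) (use l in \<open>auto simp: mat_diag_def less_imp_neq[symmetric]\<close>)
  then have LW: "\<Lambda> * W = 1\<^sub>m m"
    unfolding eq W_def mid using V VV' by simp
  \<comment> \<open>A nonzero determinant excludes the result \<open>None\<close> of
    \<open>mat_inverse\<close>; uniqueness of inverses identifies the result with W.\<close>
  have "det \<Lambda> * det W = 1" using det_mult[OF c W] by (simp add: LW)
  then have "\<Lambda> \<in> Units (ring_mat TYPE(real) m undefined)"
    by (intro det_non_zero_imp_unit[OF c]) auto
  then obtain W' where W': "mat_inverse \<Lambda> = Some W'"
    using mat_inverse(1)[OF c, of undefined] by (cases "mat_inverse \<Lambda>") auto
  have "W' * \<Lambda> = 1\<^sub>m m" and W'c: "W' \<in> carrier_mat m m" using mat_inverse(2)[OF c W'] by auto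
  then have "W = W' * \<Lambda> * W" using W by simp
  also have "\<dots> = W' * (\<Lambda> * W)" by (rule assoc_mult_mat[OF W'c c W])
  finally have "W = W'" using W'c by (simp add: LW)
  then have "mat_inv \<Lambda> = W" by (simp add: mat_inv_def W')
  then show thesis using that V VV eq l by (simp add: W_def)
qed

text \<open>Bessel's inequality for the unit vector e_l and the normalised columns. The sum is the
  l-th coordinate s_l of the projection of e_l, and it is also the squared length of that
  projection. Hence s_l^2 \<le> s_l, which forces s_l \<le> 1.\<close>

lemma orthogonal_columns_Bessel:
  fixes D :: "nat \<Rightarrow> nat \<Rightarrow> real"
  assumes orth: "\<And>i j. i \<in> I \<Longrightarrow> j \<in> I \<Longrightarrow> (\<Sum>k<m. D k i * D k j) = (if i = j then d i else 0)"
    and fin: "finite I" and d: "\<And>i. i \<in> I \<Longrightarrow> d i \<noteq> 0" and l: "l < m"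
  shows "(\<Sum>i\<in>I. (D l i)\<^sup>2 / d i) \<le> 1"
proof -
  \<comment> \<open>\<open>s\<close> is the projection of the \<open>l\<close>-th unit vector to the span of the columns in \<open>I\<close>.\<close>
  define a where "a i = D l i / d i" for i
  define s where "s k = (\<Sum>i\<in>I. a i * D k i)" for k
  have "(\<Sum>k<m. (s k)\<^sup>2) = (\<Sum>k<m. \<Sum>i\<in>I. \<Sum>j\<in>I. a i * a j * (D k i * D k j))"
    unfolding s_def power2_eq_square sum_product by (simp add: mult_ac)
  also have "\<dots> = (\<Sum>i\<in>I. \<Sum>j\<in>I. a i * a j * (\<Sum>k<m. D k i * D k j))"
    unfolding sum_distrib_left by (subst sum.swap, rule sum.cong[OF refl], rule sum.swap)
  also have "\<dots> = (\<Sum>i\<in>I. \<Sum>j\<in>I. if i = j then a i * a j * d i else 0)"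
    by (intro sum.cong refl) (simp add: orth)
  also have "\<dots> = (\<Sum>i\<in>I. a i * a i * d i)"
    using fin by simp
  also have "\<dots> = s l"
    unfolding s_def by (intro sum.cong) (auto simp: a_def d)
  finally have ss: "(\<Sum>k<m. (s k)\<^sup>2) = s l" .
  have "(s l)\<^sup>2 \<le> (\<Sum>k<m. (s k)\<^sup>2)" using l by (intro member_le_sum) auto
  then have "s l * s l \<le> s l" unfolding ss unfolding power2_eq_square .
  then have "s l \<le> 1" using mult_strict_right_mono[of 1 "s l" "s l"] by fastforce
  then show ?thesis by (simp add: s_def a_def power2_eq_square)
qed

text \<open>The Schatten bound in coordinates: \<open>d i\<close> are the squared singular values of
  X and \<open>l k\<close> the eigenvalues of \<Lambda>.\<close>

lemma orthogonal_columns_sum_powr_le: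
  fixes D :: "nat \<Rightarrow> nat \<Rightarrow> real"
  assumes orth: "\<And>i j. i < n \<Longrightarrow> j < n \<Longrightarrow> (\<Sum>k<m. D k i * D k j) = (if i = j then d i else 0)"
    and l: "\<And>k. k < m \<Longrightarrow> 0 < l k" and q: "1 \<le> q" "q < 2"
  shows "(\<Sum>i<n. sqrt (d i) powr q)
         \<le> (\<Sum>k<m. l k powr (q / (2 - q))) powr ((2 - q) / 2) * (\<Sum>i<n. \<Sum>k<m. (D k i)\<^sup>2 / l k) powr (q / 2)"
proof -
  \<comment> \<open>Zero columns are dropped, since for them the weights \<open>c\<close> would sum
    to 0 over k instead of 1.\<close>
  define I where "I = {i. i < n \<and> d i \<noteq> 0}"
  define c where "c = (\<lambda>(i, k). (D k i)\<^sup>2 / d i)"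
  have I: "finite I" "I \<subseteq> {..<n}" by (auto simp: I_def)
  have dsum: "(\<Sum>k<m. (D k i)\<^sup>2) = d i" if "i < n" for i
    using orth[OF that that] by (simp add: power2_eq_square)
  have d0: "0 \<le> d i" if "i < n" for i
    using dsum[OF that] by (metis sum_nonneg zero_le_power2)
  have dpos: "0 < d i" if "i \<in> I" for i using that d0[of i] by (auto simp: I_def)
  have c0: "0 \<le> c p" if "p \<in> I \<times> {..<m}" for p
    using that dpos by (auto simp: c_def intro!: divide_nonneg_pos)
  have csum: "(\<Sum>k<m. c (i, k)) = 1" if "i \<in> I" for i
    using that by (simp add: c_def I_def dsum flip: sum_divide_distrib)
  have Bessel: "(\<Sum>i\<in>I. c (i, k)) \<le> 1" if "k < m" for k
  proof -
    have "(\<Sum>i\<in>I. (D k i)\<^sup>2 / d i) \<le> 1"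
    proof (rule orthogonal_columns_Bessel)
      show "(\<Sum>k<m. D k i * D k j) = (if i = j then d i else 0)" if "i \<in> I" "j \<in> I" for i j
        by (rule orth) (use I that in auto)
      show "d i \<noteq> 0" if "i \<in> I" for i using that by (simp add: I_def)
    qed (use I that in auto)
    then show ?thesis by (simp add: c_def)
  qed
  have "(\<Sum>i<n. sqrt (d i) powr q) = (\<Sum>i\<in>I. sqrt (d i) powr q)"
    by (rule sum.mono_neutral_right) (auto simp: I_def)
  \<comment> \<open>The weights can be inserted because they sum to 1 over k; Hoelder then runs over
    the pairs (i, k).\<close>
  also have "\<dots> = (\<Sum>i\<in>I. \<Sum>k<m. c (i, k) * sqrt (d i) powr q)"
    by (simp add: csum flip: sum_distrib_right)
  also have "\<dots> = (\<Sum>p\<in>I \<times> {..<m}. c p * sqrt (d (fst p)) powr q)"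
    by (simp add: sum.cartesian_product case_prod_beta)
  also have "\<dots> \<le> (\<Sum>p\<in>I \<times> {..<m}. c p * l (snd p) powr (q / (2 - q))) powr ((2 - q) / 2)
      * (\<Sum>p\<in>I \<times> {..<m}. c p * ((sqrt (d (fst p)))\<^sup>2 / l (snd p))) powr (q / 2)"
    using I q c0 l d0 by (intro sum_powr_le_weighted) auto
  also have "(\<Sum>p\<in>I \<times> {..<m}. c p * l (snd p) powr (q / (2 - q)))
      = (\<Sum>k<m. (\<Sum>i\<in>I. c (i, k)) * l k powr (q / (2 - q)))"
    unfolding sum_distrib_right by (subst sum.swap) (simp add: sum.cartesian_product case_prod_beta)
  also have "(\<Sum>p\<in>I \<times> {..<m}. c p * ((sqrt (d (fst p)))\<^sup>2 / l (snd p)))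
      = (\<Sum>i\<in>I. \<Sum>k<m. (D k i)\<^sup>2 / l k)"
    unfolding sum.cartesian_product
    using dpos by (intro sum.cong) (force simp: c_def less_imp_le)+
  \<comment> \<open>Bessel removes the weights from the first factor, and the second factor regains
    the columns outside I.\<close>
  also have "(\<Sum>k<m. (\<Sum>i\<in>I. c (i, k)) * l k powr (q / (2 - q))) powr ((2 - q) / 2)
      * (\<Sum>i\<in>I. \<Sum>k<m. (D k i)\<^sup>2 / l k) powr (q / 2)
    \<le> (\<Sum>k<m. l k powr (q / (2 - q))) powr ((2 - q) / 2)
      * (\<Sum>i<n. \<Sum>k<m. (D k i)\<^sup>2 / l k) powr (q / 2)"
  proof (intro mult_mono powr_mono2)
    show "(\<Sum>k<m. (\<Sum>i\<in>I. c (i, k)) * l k powr (q / (2 - q))) \<le> (\<Sum>k<m. l k powr (q / (2 - q)))"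
      using Bessel by (intro sum_mono mult_left_le_one_le) (auto intro!: sum_nonneg c0)
    show "0 \<le> (\<Sum>k<m. (\<Sum>i\<in>I. c (i, k)) * l k powr (q / (2 - q)))"
      by (auto intro!: sum_nonneg mult_nonneg_nonneg c0)
    show "(\<Sum>i\<in>I. \<Sum>k<m. (D k i)\<^sup>2 / l k) \<le> (\<Sum>i<n. \<Sum>k<m. (D k i)\<^sup>2 / l k)"
      using I l by (intro sum_mono2) (auto intro!: sum_nonneg divide_nonneg_pos)
    show "0 \<le> (\<Sum>i\<in>I. \<Sum>k<m. (D k i)\<^sup>2 / l k)"
      using l by (auto intro!: sum_nonneg divide_nonneg_pos)
  qed (use q in auto)
  finally show ?thesis .
qed

lemma schatten_norm_square_le:
  assumes X: "X \<in> carrier_mat m n" and \<Lambda>: "sym_pos_def m \<Lambda>" and q: "q \<in> {1..2}"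
  shows "(schatten_norm (ereal q) X)\<^sup>2
         \<le> schatten_norm (if q = 2 then \<infinity> else ereal (q / (2 - q))) \<Lambda> * mat_trace (X * X\<^sup>T * mat_inv \<Lambda>)"
    and "0 \<le> mat_trace (X * X\<^sup>T * mat_inv \<Lambda>)"
proof -
  obtain V l where V: "V \<in> carrier_mat m m" and VV: "V\<^sup>T * V = 1\<^sub>m m"
    and \<Lambda>_eq: "\<Lambda> = V * mat_diag m l * V\<^sup>T" and l: "\<And>i. i < m \<Longrightarrow> 0 < l i"
    and inv: "mat_inv \<Lambda> = V * mat_diag m (\<lambda>i. 1 / l i) * V\<^sup>T"
    using sym_pos_def_diagonalization[OF \<Lambda>] by metis
  have VV': "V * V\<^sup>T = 1\<^sub>m m" using mat_mult_left_right_inverse[of "V\<^sup>T" m V] V VV by simp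
  have c: "\<Lambda> \<in> carrier_mat m m" and sym: "\<Lambda>\<^sup>T = \<Lambda>" using \<Lambda> by (auto simp: sym_pos_def_def)
  have XXc: "X\<^sup>T * X \<in> carrier_mat n n" using X by simp
  have "(X\<^sup>T * X)\<^sup>T = X\<^sup>T * X" using X by (simp add: transpose_mult[of _ n m _ n])
  from symmetric_real_mat_diagonalization[OF XXc this] obtain U d
    where U: "U \<in> carrier_mat n n" and UU: "U\<^sup>T * U = 1\<^sub>m n"
      and XX: "X\<^sup>T * X = U * mat_diag n d * U\<^sup>T" by blast
  have UU': "U * U\<^sup>T = 1\<^sub>m n" using mat_mult_left_right_inverse[of "U\<^sup>T" n U] U UU by simp
  note dims = carrier_matD[OF V] carrier_matD[OF U] carrier_matD[OF X]
  \<comment> \<open>D is X in the eigenbases of \<Lambda> on the left and of X^T X on the right. The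
    identity D^T D = diag(d) says that its columns are orthogonal with squared lengths
    \<open>d i\<close>.\<close>
  define D where "D = V\<^sup>T * X * U"
  have D: "D \<in> carrier_mat m n" unfolding D_def by (rule carrier_matI) (simp_all add: dims)
  have DT: "D\<^sup>T = U\<^sup>T * X\<^sup>T * V"
  proof -
    have VX: "V\<^sup>T * X \<in> carrier_mat m n" by (rule carrier_matI) (simp_all add: dims)
    have "D\<^sup>T = U\<^sup>T * (V\<^sup>T * X)\<^sup>T"
      unfolding D_def by (rule transpose_mult[OF VX U])
    also have "(V\<^sup>T * X)\<^sup>T = X\<^sup>T * V"
      using transpose_mult[of "V\<^sup>T" m m X n] V X by simp
    finally show ?thesis by (simp add: dims mult_mat_assoc)
  qed
  have "D\<^sup>T * D = U\<^sup>T * (X\<^sup>T * (V * V\<^sup>T) * X) * U"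
    unfolding DT unfolding D_def
    by (simp add: dims mult_mat_assoc)
  also have "X\<^sup>T * (V * V\<^sup>T) * X = U * mat_diag n d * U\<^sup>T"
    using X by (simp add: VV' XX)
  also have "U\<^sup>T * (U * mat_diag n d * U\<^sup>T) * U = (U\<^sup>T * U) * mat_diag n d * (U\<^sup>T * U)"
    by (simp add: dims mult_mat_assoc)
  also have "\<dots> = mat_diag n d" by (simp add: UU)
  finally have DTD: "D\<^sup>T * D = mat_diag n d" .
  have orth: "(\<Sum>k<m. D $$ (k, i) * D $$ (k, j)) = (if i = j then d i else 0)"
    if ij: "i < n" "j < n" for i j
  proof -
    have "(if i = j then d i else 0) = (D\<^sup>T * D) $$ (i, j)"
      using ij by (simp add: DTD mat_diag_def)
    also have "\<dots> = (\<Sum>k<m. D\<^sup>T $$ (i, k) * D $$ (k, j))"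
      by (rule index_mult_mat_sum) (use D ij in auto)
    also have "\<dots> = (\<Sum>k<m. D $$ (k, i) * D $$ (k, j))"
      using D ij by (intro sum.cong) auto
    finally show ?thesis by (rule HOL.sym)
  qed
  have d0: "0 \<le> d i" if "i < n" for i
  proof -
    have "0 \<le> (\<Sum>k<m. D $$ (k, i) * D $$ (k, i))" by (intro sum_nonneg) auto
    then show ?thesis by (simp only: orth[OF that that] if_True simp_thms)
  qed
  define T where "T = (\<Sum>i<n. \<Sum>k<m. (D $$ (k, i))\<^sup>2 / l k)"
  have T0: "0 \<le> T" unfolding T_def using l by (auto intro!: sum_nonneg divide_nonneg_pos)
  have DDT: "D * D\<^sup>T = V\<^sup>T * (X * X\<^sup>T) * V"
  proof -
    have "D * D\<^sup>T = V\<^sup>T * (X * (U * U\<^sup>T) * X\<^sup>T) * V"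
      unfolding DT unfolding D_def
      by (simp add: dims mult_mat_assoc)
    then show ?thesis using X by (simp add: UU')
  qed
  \<comment> \<open>Cycling V^T to the front makes the trace pair the diagonal of D D^T with the
    reciprocals 1 / l_k.\<close>
  have trace: "mat_trace (X * X\<^sup>T * mat_inv \<Lambda>) = T"
  proof -
    let ?L = "mat_diag m (\<lambda>i. 1 / l i)"
    have XXT: "X * X\<^sup>T \<in> carrier_mat m m" using X by simp
    have "mat_trace (X * X\<^sup>T * mat_inv \<Lambda>) = mat_trace ((X * X\<^sup>T * V * ?L) * V\<^sup>T)"
      unfolding inv by (simp add: dims mult_mat_assoc)
    also have "\<dots> = mat_trace (V\<^sup>T * (X * X\<^sup>T * V * ?L))"
      by (rule mat_trace_comm[of _ m m]; rule carrier_matI) (simp_all add: dims)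
    also have "V\<^sup>T * (X * X\<^sup>T * V * ?L) = (V\<^sup>T * (X * X\<^sup>T) * V) * ?L"
      by (simp add: dims mult_mat_assoc)
    also have "\<dots> = mat m m (\<lambda>(i, j). (D * D\<^sup>T) $$ (i, j) * (1 / l j))"
      unfolding DDT[symmetric] using D by (intro mat_diag_mult_right) auto
    also have "mat_trace \<dots> = (\<Sum>k<m. (D * D\<^sup>T) $$ (k, k) * (1 / l k))"
      by (simp add: mat_trace_def)
    also have "\<dots> = (\<Sum>k<m. \<Sum>i<n. (D $$ (k, i))\<^sup>2 / l k)"
    proof (rule sum.cong[OF refl])
      fix k assume "k \<in> {..<m}"
      then have k: "k < m" by simp
      have "(D * D\<^sup>T) $$ (k, k) = (\<Sum>i<n. D $$ (k, i) * D\<^sup>T $$ (i, k))"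
        by (rule index_mult_mat_sum) (use D k in auto)
      also have "\<dots> = (\<Sum>i<n. (D $$ (k, i))\<^sup>2)"
        using D k by (intro sum.cong) (auto simp: power2_eq_square)
      finally show "(D * D\<^sup>T) $$ (k, k) * (1 / l k) = (\<Sum>i<n. (D $$ (k, i))\<^sup>2 / l k)"
        by (simp add: sum_divide_distrib)
    qed
    also have "\<dots> = T" unfolding T_def by (rule sum.swap)
    finally show ?thesis .
  qed
  show "0 \<le> mat_trace (X * X\<^sup>T * mat_inv \<Lambda>)" using T0 trace by simp
  \<comment> \<open>V also diagonalises \<Lambda>^T \<Lambda>, with entries l_k^2; as l_k > 0, the
    singular values of \<Lambda> are the l_k themselves.\<close>
  have \<Lambda>2: "\<Lambda>\<^sup>T * \<Lambda> = V * mat_diag m (\<lambda>i. l i * l i) * V\<^sup>T"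
  proof -
    have "\<Lambda>\<^sup>T * \<Lambda> = V * mat_diag m l * (V\<^sup>T * V) * mat_diag m l * V\<^sup>T"
      unfolding sym unfolding \<Lambda>_eq by (simp add: dims mult_mat_assoc)
    also have "\<dots> = V * (mat_diag m l * mat_diag m l) * V\<^sup>T"
      using V by (simp add: VV dims mult_mat_assoc del: mat_diag_diag)
    finally show ?thesis by simp
  qed
  have sl: "sqrt (l i * l i) = l i" if "i < m" for i using l[OF that] by simp
  have SX: "schatten_norm (ereal q) X = (\<Sum>i<n. sqrt (d i) powr q) powr (1 / q)"
    by (rule schatten_norm_diagonalized[OF X U UU XX d0])
  show "(schatten_norm (ereal q) X)\<^sup>2
         \<le> schatten_norm (if q = 2 then \<infinity> else ereal (q / (2 - q))) \<Lambda> * mat_trace (X * X\<^sup>T * mat_inv \<Lambda>)"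
  proof (cases "q = 2")
    \<comment> \<open>For q = 2 the exponent q / (2 - q) degenerates and the bound is direct: the
      squared norm is the sum of all D_ki^2, and each l_k is at most \<open>b\<close>.\<close>
    case True
    define b where "b = schatten_norm \<infinity> \<Lambda>"
    have b: "b = Max (insert 0 (l ` {..<m}))"
      unfolding b_def using schatten_norm_infinity_diagonalized[OF c V VV \<Lambda>2] sl by simp
    have lb: "l k \<le> b" if "k < m" for k unfolding b using that by (intro Max_ge) auto
    have "sqrt (d i) powr 2 = d i" if "i < n" for i
      using d0[OF that] by (cases "d i = 0") simp_all
    then have "schatten_norm (ereal q) X = (\<Sum>i<n. d i) powr (1 / 2)"
      using SX True by simp
    then have "(schatten_norm (ereal q) X)\<^sup>2 = (\<Sum>i<n. d i)"
      using sum_nonneg[of "{..<n}" d] d0 by (simp add: powr_half_sqrt)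
    also have "\<dots> = (\<Sum>i<n. \<Sum>k<m. (D $$ (k, i))\<^sup>2)"
      by (intro sum.cong) (auto simp: orth power2_eq_square)
    also have "\<dots> \<le> (\<Sum>i<n. \<Sum>k<m. b * ((D $$ (k, i))\<^sup>2 / l k))"
    proof (intro sum_mono)
      fix i k assume "k \<in> {..<m}"
      then have "0 < l k" "l k \<le> b" using l lb by auto
      then have "l k * ((D $$ (k, i))\<^sup>2 / l k) \<le> b * ((D $$ (k, i))\<^sup>2 / l k)"
        by (intro mult_right_mono divide_nonneg_pos) auto
      then show "(D $$ (k, i))\<^sup>2 \<le> b * ((D $$ (k, i))\<^sup>2 / l k)"
        using \<open>0 < l k\<close> by simp
    qed
    also have "\<dots> = b * T" unfolding T_def by (simp add: sum_distrib_left)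
    finally show ?thesis using True by (simp add: trace b_def)
  next
    case False
    with q have q: "1 \<le> q" "q < 2" by auto
    define S where "S = (\<Sum>i<n. sqrt (d i) powr q)"
    define P where "P = (\<Sum>k<m. l k powr (q / (2 - q)))"
    have S0: "0 \<le> S" unfolding S_def by (auto intro!: sum_nonneg)
    have SL: "schatten_norm (ereal (q / (2 - q))) \<Lambda> = P powr ((2 - q) / q)"
      unfolding P_def using schatten_norm_diagonalized[OF c V VV \<Lambda>2] sl by simp
    have "S \<le> P powr ((2 - q) / 2) * T powr (q / 2)"
      unfolding S_def P_def T_def
      by (rule orthogonal_columns_sum_powr_le) (use orth l q in auto)
    then have "(S powr (1 / q))\<^sup>2 \<le> P powr ((2 - q) / q) * T"
      using S0 T0 q by (intro square_powr_inverse_le) auto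
    then show ?thesis using False by (simp only: SX S_def SL trace if_False)
  qed
qed

section \<open>Second moments\<close>

text \<open>Pointwise Hoelder bounds the squared norm by a linear combination \<open>F\<close> of
  the majorants \<open>y j\<close>, whose mean is exactly the right-hand side. The norm itself
  enters only through monotonicity of the nonnegative integral, so integrability is established for
  \<open>F\<close> alone.\<close>

lemma nn_integral_lp_norm_square_le:
  fixes x y :: "'i \<Rightarrow> 'a \<Rightarrow> real" and B :: "'i \<Rightarrow> real"
  assumes fin: "finite I" and \<beta>: "\<beta> \<in> {1..2}"
    and x: "\<And>j \<omega>. j \<in> I \<Longrightarrow> 0 \<le> x j \<omega>" and xy: "\<And>j \<omega>. j \<in> I \<Longrightarrow> (x j \<omega>)\<^sup>2 \<le> y j \<omega>"
    and y: "\<And>j. j \<in> I \<Longrightarrow> integrable M (y j)" "\<And>j. j \<in> I \<Longrightarrow> integral\<^sup>L M (y j) = (B j)\<^sup>2"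
    and B: "\<And>j. j \<in> I \<Longrightarrow> 0 \<le> B j"
  shows "(\<integral>\<^sup>+ \<omega>. ennreal ((lp_norm (ereal \<beta>) I (\<lambda>j. x j \<omega>))\<^sup>2) \<partial>M) \<le> ennreal ((lp_norm (ereal \<beta>) I B)\<^sup>2)"
proof -
  have \<beta>': "1 \<le> \<beta>" "\<beta> \<le> 2" using \<beta> by auto
  have y0: "0 \<le> y j \<omega>" if "j \<in> I" for j \<omega> using xy[OF that, of \<omega>] by (meson order_trans zero_le_power2)
  \<comment> \<open>Where \<open>B j = 0\<close> the weight \<open>B j powr (2 - \<beta>)\<close> is useless, but there \<open>x j\<close> vanishes almost everywhere.\<close>
  define K where "K = {j \<in> I. 0 < B j}"
  have K: "finite K" "K \<subseteq> I" using fin by (auto simp: K_def)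
  define N where "N = (\<Sum>j\<in>K. B j powr \<beta>)"
  have N0: "0 \<le> N" by (simp add: N_def sum_nonneg)
  define F where "F \<omega> = N powr ((2 - \<beta>) / \<beta>) * (\<Sum>j\<in>K. y j \<omega> / B j powr (2 - \<beta>))" for \<omega>
  have F0: "0 \<le> F \<omega>" for \<omega>
    using y0 K by (auto simp: F_def intro!: mult_nonneg_nonneg sum_nonneg)
  have intF: "integrable M F"
    unfolding F_def using y(1) K by (intro integrable_mult_right Bochner_Integration.integrable_sum) auto
  \<comment> \<open>Each quotient has mean B_j^2 / B_j^(2-\<beta>) = B_j^\<beta>, so the sum is N,
    and N^((2-\<beta>)/\<beta>) N = N^(2/\<beta>).\<close>
  have "integral\<^sup>L M F = N powr ((2 - \<beta>) / \<beta>) * (\<Sum>j\<in>K. integral\<^sup>L M (y j) / B j powr (2 - \<beta>))"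
    unfolding F_def using y(1) K by (subst integral_mult_right_zero, subst Bochner_Integration.integral_sum) auto
  also have "(\<Sum>j\<in>K. integral\<^sup>L M (y j) / B j powr (2 - \<beta>)) = N"
    unfolding N_def
  proof (rule sum.cong[OF refl])
    fix j assume "j \<in> K"
    then have j: "j \<in> I" "0 < B j" by (auto simp: K_def)
    have "B j powr \<beta> * B j powr (2 - \<beta>) = (B j)\<^sup>2"
      using j by (simp flip: powr_add)
    then show "integral\<^sup>L M (y j) / B j powr (2 - \<beta>) = B j powr \<beta>"
      using j by (simp add: y divide_simps)
  qed
  also have "N powr ((2 - \<beta>) / \<beta>) * N = (N powr (1 / \<beta>))\<^sup>2"
  proof (cases "N = 0")
    case False
    then have "N powr ((2 - \<beta>) / \<beta>) * N = N powr ((2 - \<beta>) / \<beta> + 1)" using N0 by (simp add: powr_add)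
    also have "(2 - \<beta>) / \<beta> + 1 = 1 / \<beta> + 1 / \<beta>" using \<beta>' by (simp add: field_simps)
    finally show ?thesis by (simp only: powr_add power2_eq_square)
  qed simp
  also have "N = (\<Sum>j\<in>I. \<bar>B j\<bar> powr \<beta>)"
    unfolding N_def K_def using B fin by (intro sum.mono_neutral_cong_left) (auto simp: less_le)
  also have "((\<Sum>j\<in>I. \<bar>B j\<bar> powr \<beta>) powr (1 / \<beta>))\<^sup>2 = (lp_norm (ereal \<beta>) I B)\<^sup>2"
    by (simp add: lp_norm_def)
  finally have IF: "integral\<^sup>L M F = (lp_norm (ereal \<beta>) I B)\<^sup>2" .
  have "AE \<omega> in M. y j \<omega> = 0" if "j \<in> I - K" for j
  proof -
    have j: "j \<in> I" "B j = 0" using that B[of j] by (auto simp: K_def)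
    then have "integral\<^sup>L M (y j) = 0" by (simp add: y)
    then show ?thesis using integral_nonneg_eq_0_iff_AE[OF y(1)[OF j(1)]] y0[OF j(1)] by simp
  qed
  then have "AE \<omega> in M. \<forall>j\<in>I - K. y j \<omega> = 0" using fin by (subst AE_finite_all) auto
  then have "AE \<omega> in M. (lp_norm (ereal \<beta>) I (\<lambda>j. x j \<omega>))\<^sup>2 \<le> F \<omega>"
  proof (eventually_elim)
    case (elim \<omega>)
    define S where "S = (\<Sum>j\<in>K. x j \<omega> powr \<beta>)"
    have x0: "x j \<omega> = 0" if "j \<in> I" "j \<notin> K" for j
      using xy[OF that(1), of \<omega>] elim that by auto
    have "(\<Sum>j\<in>I. \<bar>x j \<omega>\<bar> powr \<beta>) = S"
      unfolding S_def using K fin x x0 by (intro sum.mono_neutral_cong_right) (auto simp: subset_iff)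
    then have lp: "lp_norm (ereal \<beta>) I (\<lambda>j. x j \<omega>) = S powr (1 / \<beta>)"
      by (simp add: lp_norm_def)
    have S0: "0 \<le> S" by (simp add: S_def sum_nonneg)
    define T where "T = (\<Sum>j\<in>K. (x j \<omega>)\<^sup>2 / B j powr (2 - \<beta>))"
    have T0: "0 \<le> T" by (simp add: T_def sum_nonneg)
    have "(S powr (1 / \<beta>))\<^sup>2 \<le> N powr ((2 - \<beta>) / \<beta>) * T"
    proof (cases "\<beta> = 2")
      case True
      have pos: "0 < B j" if "j \<in> K" for j using that by (simp add: K_def)
      have "x j \<omega> powr 2 = (x j \<omega>)\<^sup>2" if "j \<in> K" for j
        using x[of j \<omega>] that K by (cases "x j \<omega> = 0") auto
      then have ST: "S = T"
        unfolding S_def T_def True using pos by (intro sum.cong) (auto simp: less_imp_neq[symmetric])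
      \<comment> \<open>The factor N^0 is 1 only for N > 0, since \<open>0 powr 0 = 0\<close>. If K
        is empty, both sides are 0.\<close>
      show ?thesis
      proof (cases "K = {}")
        case False
        then have "0 < N" unfolding N_def using K pos by (intro sum_pos) (auto simp: less_imp_neq[symmetric])
        then show ?thesis using True ST T0 by (simp add: powr_half_sqrt)
      qed (simp add: S_def T_def)
    next
      case False
      with \<beta>' have \<beta>2: "\<beta> < 2" by simp
      \<comment> \<open>The weights B_j^(2-\<beta>), raised to the power \<beta> / (2 - \<beta>),
        become B_j^\<beta> and sum to N.\<close>
      have "S \<le> (\<Sum>j\<in>K. 1 * (B j powr (2 - \<beta>)) powr (\<beta> / (2 - \<beta>))) powr ((2 - \<beta>) / 2)
             * (\<Sum>j\<in>K. 1 * ((x j \<omega>)\<^sup>2 / B j powr (2 - \<beta>))) powr (\<beta> / 2)"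
        using sum_powr_le_weighted[of K "\<lambda>_. 1" "\<lambda>j. x j \<omega>" "\<lambda>j. B j powr (2 - \<beta>)" \<beta>] K x \<beta>' \<beta>2
        by (auto simp: S_def K_def)
      also have "\<dots> = N powr ((2 - \<beta>) / 2) * T powr (\<beta> / 2)"
        using \<beta>2 by (simp add: N_def T_def powr_powr)
      finally show ?thesis using S0 T0 \<beta>' by (intro square_powr_inverse_le) auto
    qed
    also have "T \<le> (\<Sum>j\<in>K. y j \<omega> / B j powr (2 - \<beta>))"
      unfolding T_def using xy K by (intro sum_mono divide_right_mono) auto
    then have "N powr ((2 - \<beta>) / \<beta>) * T \<le> F \<omega>"
      unfolding F_def by (intro mult_left_mono) auto
    finally show ?case by (simp add: lp)
  qed
  then have "(\<integral>\<^sup>+ \<omega>. ennreal ((lp_norm (ereal \<beta>) I (\<lambda>j. x j \<omega>))\<^sup>2) \<partial>M) \<le> (\<integral>\<^sup>+ \<omega>. ennreal (F \<omega>) \<partial>M)"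
    by (intro nn_integral_mono_AE) (auto elim!: eventually_mono intro!: ennreal_leI)
  also have "\<dots> = ennreal (integral\<^sup>L M F)"
    using intF F0 by (intro nn_integral_eq_integral) auto
  finally show ?thesis by (simp add: IF)
qed

section \<open>The generated filtration and orthogonality of martingale differences\<close>

lemma subalgebra_gen_sigma:
  assumes "\<And>s j. j \<in> {1..J} \<Longrightarrow> random_mat M (m j) (n j) (A s j)"
  shows "subalgebra M (gen_sigma M J m n A t)"
proof -
  let ?G = "{(\<lambda>\<omega>. A s j \<omega> $$ (r, c)) -` S \<inter> space M | s j r c S.
        s \<le> t \<and> j \<in> {1..J} \<and> r < m j \<and> c < n j \<and> S \<in> sets borel}"
  have "?G \<subseteq> sets M"
  proof
    fix E assume "E \<in> ?G"
    then obtain s j r c S where E: "E = (\<lambda>\<omega>. A s j \<omega> $$ (r, c)) -` S \<inter> space M" "S \<in> sets borel"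
      and *: "j \<in> {1..J}" "r < m j" "c < n j" by blast
    have "(\<lambda>\<omega>. A s j \<omega> $$ (r, c)) \<in> borel_measurable M"
      using assms[OF *(1), of s] * by (simp add: random_mat_def)
    then show "E \<in> sets M" using E by (simp add: measurable_sets)
  qed
  moreover have "?G \<subseteq> Pow (space M)" by auto
  ultimately show ?thesis
    unfolding subalgebra_def gen_sigma_def
    by (simp add: space_measure_of sets_measure_of sets.sigma_sets_subset)
qed

lemma measurable_gen_sigma:
  assumes "s \<le> t" "j \<in> {1..J}" "r < m j" "c < n j"
  shows "(\<lambda>\<omega>. A s j \<omega> $$ (r, c)) \<in> borel_measurable (gen_sigma M J m n A t)"
proof (rule measurableI)
  let ?G = "{(\<lambda>\<omega>. A s j \<omega> $$ (r, c)) -` S \<inter> space M | s j r c S.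
        s \<le> t \<and> j \<in> {1..J} \<and> r < m j \<and> c < n j \<and> S \<in> sets borel}"
  have G: "?G \<subseteq> Pow (space M)" by auto
  fix S :: "real set" assume "S \<in> sets borel"
  then have "(\<lambda>\<omega>. A s j \<omega> $$ (r, c)) -` S \<inter> space M \<in> ?G" using assms by blast
  then show "(\<lambda>\<omega>. A s j \<omega> $$ (r, c)) -` S \<inter> space (gen_sigma M J m n A t) \<in> sets (gen_sigma M J m n A t)"
    unfolding gen_sigma_def using G by (simp add: space_measure_of sets_measure_of sigma_sets.Basic)
qed simp

text \<open>The diagonal entry (r, r) of X X^T is the sum of the squares of row r and dominates each
  of them.\<close>

lemma integrable_square_entry:
  assumes X: "random_mat M m n X" and int: "mat_integrable M m m (\<lambda>\<omega>. X \<omega> * (X \<omega>)\<^sup>T)"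
    and rc: "r < m" "c < n"
  shows "integrable M (\<lambda>\<omega>. (X \<omega> $$ (r, c))\<^sup>2)"
proof (rule Bochner_Integration.integrable_bound)
  show "integrable M (\<lambda>\<omega>. (X \<omega> * (X \<omega>)\<^sup>T) $$ (r, r))"
    using int rc by (simp add: mat_integrable_def)
  show "(\<lambda>\<omega>. (X \<omega> $$ (r, c))\<^sup>2) \<in> borel_measurable M"
    using X rc unfolding random_mat_def by (intro borel_measurable_power) auto
  have "(X \<omega> $$ (r, c))\<^sup>2 \<le> (X \<omega> * (X \<omega>)\<^sup>T) $$ (r, r)" if "\<omega> \<in> space M" for \<omega>
  proof -
    have c: "X \<omega> \<in> carrier_mat m n" using X that by (simp add: random_mat_def)
    have "(X \<omega> * (X \<omega>)\<^sup>T) $$ (r, r) = (\<Sum>k<n. X \<omega> $$ (r, k) * (X \<omega>)\<^sup>T $$ (k, r))"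
      by (rule index_mult_mat_sum) (use c rc in auto)
    also have "\<dots> = (\<Sum>k<n. (X \<omega> $$ (r, k))\<^sup>2)"
      using c rc by (intro sum.cong) (auto simp: power2_eq_square)
    also have "(X \<omega> $$ (r, c))\<^sup>2 \<le> \<dots>"
      using rc by (intro member_le_sum) auto
    finally show ?thesis .
  qed
  then show "AE \<omega> in M. norm ((X \<omega> $$ (r, c))\<^sup>2) \<le> norm ((X \<omega> * (X \<omega>)\<^sup>T) $$ (r, r))"
    by (intro AE_I2) (simp only: real_norm_def abs_power2, rule order_trans[OF _ abs_ge_self])
qed

lemma integrable_mult_of_square:
  fixes f g :: "'a \<Rightarrow> real"
  assumes "f \<in> borel_measurable M" "g \<in> borel_measurable M"
    and "integrable M (\<lambda>\<omega>. (f \<omega>)\<^sup>2)" "integrable M (\<lambda>\<omega>. (g \<omega>)\<^sup>2)"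
  shows "integrable M (\<lambda>\<omega>. f \<omega> * g \<omega>)"
proof (rule Bochner_Integration.integrable_bound)
  show "integrable M (\<lambda>\<omega>. (f \<omega>)\<^sup>2 + (g \<omega>)\<^sup>2)" using assms by simp
  show "AE \<omega> in M. norm (f \<omega> * g \<omega>) \<le> norm ((f \<omega>)\<^sup>2 + (g \<omega>)\<^sup>2)"
  proof (intro AE_I2)
    fix \<omega>
    have "2 * \<bar>f \<omega> * g \<omega>\<bar> \<le> (f \<omega>)\<^sup>2 + (g \<omega>)\<^sup>2"
      using sum_squares_bound[of "\<bar>f \<omega>\<bar>" "\<bar>g \<omega>\<bar>"] by (simp add: abs_mult)
    then show "norm (f \<omega> * g \<omega>) \<le> norm ((f \<omega>)\<^sup>2 + (g \<omega>)\<^sup>2)" by simp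
  qed
qed (use assms in measurable)

text \<open>The trace expands into a double sum over s and t of products of entries, and the terms
  with s \<noteq> t have mean 0. Since Y Y^T pairs entries of the same column only,
  \<open>int\<close> and \<open>orth\<close> speak of one common column c.\<close>

lemma integral_trace_mat_sum:
  fixes X :: "nat \<Rightarrow> 'a \<Rightarrow> real mat" and W :: "real mat" and k :: nat
  assumes X: "\<And>t. random_mat M m n (X t)" and W: "W \<in> carrier_mat m m"
    and int: "\<And>s t r r' c. r < m \<Longrightarrow> r' < m \<Longrightarrow> c < n \<Longrightarrow> integrable M (\<lambda>\<omega>. X s \<omega> $$ (r, c) * X t \<omega> $$ (r', c))"
    and orth: "\<And>s t r r' c. s \<noteq> t \<Longrightarrow> r < m \<Longrightarrow> r' < m \<Longrightarrow> c < n \<Longrightarrow>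
        (\<integral>\<omega>. X s \<omega> $$ (r, c) * X t \<omega> $$ (r', c) \<partial>M) = 0"
  defines "S \<equiv> (\<lambda>\<omega>. mat_sum m n (\<lambda>t. X t \<omega>) {..<k})"
  shows "integrable M (\<lambda>\<omega>. mat_trace (S \<omega> * (S \<omega>)\<^sup>T * W))"
    and "(\<integral>\<omega>. mat_trace (S \<omega> * (S \<omega>)\<^sup>T * W) \<partial>M)
         = (\<Sum>t<k. mat_trace (mat_expectation M m m (\<lambda>\<omega>. X t \<omega> * (X t \<omega>)\<^sup>T) * W))"
proof -
  have tr: "mat_trace (Y * W) = (\<Sum>r<m. \<Sum>r'<m. Y $$ (r, r') * W $$ (r', r))" if Y: "Y \<in> carrier_mat m m" for Y
    unfolding mat_trace_def using Y W
    by (auto intro!: sum.cong index_mult_mat_sum simp del: index_mult_mat(1))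
  have prod: "(Y * Y\<^sup>T) $$ (r, r') = (\<Sum>c<n. Y $$ (r, c) * Y $$ (r', c))"
    if Y: "Y \<in> carrier_mat m n" and r: "r < m" "r' < m" for Y :: "real mat" and r r'
  proof -
    have "(Y * Y\<^sup>T) $$ (r, r') = (\<Sum>c<n. Y $$ (r, c) * Y\<^sup>T $$ (c, r'))"
      by (rule index_mult_mat_sum) (use Y r in auto)
    also have "\<dots> = (\<Sum>c<n. Y $$ (r, c) * Y $$ (r', c))"
      using Y r by (intro sum.cong) auto
    finally show ?thesis .
  qed
  define E where "E t r r' c = (\<integral>\<omega>. X t \<omega> $$ (r, c) * X t \<omega> $$ (r', c) \<partial>M)" for t r r' c
  have S: "S \<omega> \<in> carrier_mat m n" for \<omega> by (simp add: S_def mat_sum_def)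
  have SS: "S \<omega> * (S \<omega>)\<^sup>T \<in> carrier_mat m m" for \<omega> using S[of \<omega>] by simp
  have Sentry: "(S \<omega> * (S \<omega>)\<^sup>T) $$ (r, r') = (\<Sum>c<n. \<Sum>s<k. \<Sum>t<k. X s \<omega> $$ (r, c) * X t \<omega> $$ (r', c))"
    if "r < m" "r' < m" for r r' \<omega>
    unfolding prod[OF S that] using that
    by (intro sum.cong refl) (simp add: S_def mat_sum_def sum_product)
  have intS: "integrable M (\<lambda>\<omega>. (S \<omega> * (S \<omega>)\<^sup>T) $$ (r, r'))" if "r < m" "r' < m" for r r'
    unfolding Sentry[OF that] using that by (intro Bochner_Integration.integrable_sum int) auto
  show "integrable M (\<lambda>\<omega>. mat_trace (S \<omega> * (S \<omega>)\<^sup>T * W))"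
    unfolding tr[OF SS] by (intro Bochner_Integration.integrable_sum integrable_mult_left intS) auto
  have ES: "(\<integral>\<omega>. (S \<omega> * (S \<omega>)\<^sup>T) $$ (r, r') \<partial>M) = (\<Sum>t<k. \<Sum>c<n. E t r r' c)" if r: "r < m" "r' < m" for r r'
  proof -
    have "(\<integral>\<omega>. (S \<omega> * (S \<omega>)\<^sup>T) $$ (r, r') \<partial>M)
        = (\<Sum>c<n. \<Sum>s<k. \<Sum>t<k. \<integral>\<omega>. X s \<omega> $$ (r, c) * X t \<omega> $$ (r', c) \<partial>M)"
      unfolding Sentry[OF r] using int[OF r]
      by (simp add: Bochner_Integration.integral_sum Bochner_Integration.integrable_sum)
    also have "\<dots> = (\<Sum>c<n. \<Sum>s<k. \<Sum>t<k. if s = t then E s r r' c else 0)"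
      by (intro sum.cong refl) (auto simp: E_def orth r)
    also have "\<dots> = (\<Sum>c<n. \<Sum>t<k. E t r r' c)" by simp
    finally show ?thesis by (subst sum.swap)
  qed
  have EX: "mat_expectation M m m (\<lambda>\<omega>. X t \<omega> * (X t \<omega>)\<^sup>T) $$ (r, r') = (\<Sum>c<n. E t r r' c)"
    if r: "r < m" "r' < m" for t r r'
  proof -
    have "mat_expectation M m m (\<lambda>\<omega>. X t \<omega> * (X t \<omega>)\<^sup>T) $$ (r, r')
        = (\<integral>\<omega>. (X t \<omega> * (X t \<omega>)\<^sup>T) $$ (r, r') \<partial>M)"
      unfolding mat_expectation_def using r by simp
    also have "\<dots> = (\<integral>\<omega>. (\<Sum>c<n. X t \<omega> $$ (r, c) * X t \<omega> $$ (r', c)) \<partial>M)"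
      using X r unfolding random_mat_def by (intro Bochner_Integration.integral_cong refl prod) auto
    also have "\<dots> = (\<Sum>c<n. E t r r' c)"
      unfolding E_def using int[OF r] by (intro Bochner_Integration.integral_sum) auto
    finally show ?thesis .
  qed
  have EXc: "mat_expectation M m m Y \<in> carrier_mat m m" for Y by (simp add: mat_expectation_def)
  have "(\<integral>\<omega>. mat_trace (S \<omega> * (S \<omega>)\<^sup>T * W) \<partial>M)
      = (\<Sum>r<m. \<Sum>r'<m. (\<integral>\<omega>. (S \<omega> * (S \<omega>)\<^sup>T) $$ (r, r') \<partial>M) * W $$ (r', r))"
  proof -
    have int1: "integrable M (\<lambda>\<omega>. (S \<omega> * (S \<omega>)\<^sup>T) $$ (r, r') * W $$ (r', r))"
      if "r < m" "r' < m" for r r' using intS[OF that] by (rule integrable_mult_left)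
    show ?thesis
      unfolding tr[OF SS]
      by (subst Bochner_Integration.integral_sum, (intro Bochner_Integration.integrable_sum int1; simp),
          rule sum.cong[OF refl], subst Bochner_Integration.integral_sum, (intro int1; simp),
          rule sum.cong[OF refl], rule integral_mult_left_zero)
  qed
  also have "\<dots> = (\<Sum>r<m. \<Sum>r'<m. \<Sum>t<k. (\<Sum>c<n. E t r r' c) * W $$ (r', r))"
    by (intro sum.cong refl) (simp add: ES sum_distrib_right del: index_mult_mat(1))
  also have "\<dots> = (\<Sum>t<k. \<Sum>r<m. \<Sum>r'<m. (\<Sum>c<n. E t r r' c) * W $$ (r', r))"
    by (subst (2) sum.swap, subst sum.swap) (rule refl)
  also have "\<dots> = (\<Sum>t<k. mat_trace (mat_expectation M m m (\<lambda>\<omega>. X t \<omega> * (X t \<omega>)\<^sup>T) * W))"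
    unfolding tr[OF EXc] by (intro sum.cong refl) (simp add: EX)
  finally show "(\<integral>\<omega>. mat_trace (S \<omega> * (S \<omega>)\<^sup>T * W) \<partial>M)
         = (\<Sum>t<k. mat_trace (mat_expectation M m m (\<lambda>\<omega>. X t \<omega> * (X t \<omega>)\<^sup>T) * W))" .
qed

text \<open>Entrywise, E[A_s A_t] = E[A_s E[A_t | F_(t-1)]] = 0, because the earlier factor can be
  pulled out of the conditional expectation.\<close>

lemma martingale_difference_orthogonal:
  fixes A :: "nat \<Rightarrow> nat \<Rightarrow> 'a \<Rightarrow> real mat"
  assumes M: "prob_space M" and A: "\<And>s j. j \<in> {1..J} \<Longrightarrow> random_mat M (m j) (n j) (A s j)"
    and cond: "AE \<omega> in M. mat_cond_exp M (gen_sigma M J m n A (t - 1)) (m j) (n j) (A t j) \<omega> = 0\<^sub>m (m j) (n j)"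
    and st: "s < t" and j: "j \<in> {1..J}" and rc: "r < m j" "c < n j" "r' < m j" "c' < n j"
    and int: "integrable M (\<lambda>\<omega>. A s j \<omega> $$ (r, c) * A t j \<omega> $$ (r', c'))"
  shows "(\<integral>\<omega>. A s j \<omega> $$ (r, c) * A t j \<omega> $$ (r', c') \<partial>M) = 0"
proof -
  let ?F = "gen_sigma M J m n A (t - 1)"
  interpret prob_space M by (rule M)
  interpret F: finite_measure_subalgebra M ?F
    by unfold_locales (rule subalgebra_gen_sigma[OF A])
  have mA: "(\<lambda>\<omega>. A t j \<omega> $$ (r', c')) \<in> borel_measurable M"
    using A[OF j, of t] rc by (simp add: random_mat_def)
  \<comment> \<open>From \<open>s < t\<close> it follows that t \<ge> 1, so \<open>t - 1\<close> is
    not truncated and s \<le> t - 1.\<close>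
  have mF: "(\<lambda>\<omega>. A s j \<omega> $$ (r, c)) \<in> borel_measurable ?F"
    using st j rc by (intro measurable_gen_sigma) auto
  have "AE \<omega> in M. real_cond_exp M ?F (\<lambda>\<omega>. A t j \<omega> $$ (r', c')) \<omega> = 0"
    using cond
  proof eventually_elim
    case (elim \<omega>)
    from arg_cong[OF elim, of "\<lambda>X. X $$ (r', c')"] show ?case using rc by (simp add: mat_cond_exp_def)
  qed
  then have "AE \<omega> in M. A s j \<omega> $$ (r, c) * real_cond_exp M ?F (\<lambda>\<omega>. A t j \<omega> $$ (r', c')) \<omega> = 0"
    by eventually_elim simp
  then have "(\<integral>\<omega>. A s j \<omega> $$ (r, c) * real_cond_exp M ?F (\<lambda>\<omega>. A t j \<omega> $$ (r', c')) \<omega> \<partial>M) = 0"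
    by (rule integral_eq_zero_AE)
  then show ?thesis using F.real_cond_exp_intg(2)[OF int mF mA] by simp
qed

section \<open>Reduction of the mixed norm to the bounds for the blocks\<close>

theorem lemma11:
  fixes M :: "'a measure"
    and J :: nat and m n :: "nat \<Rightarrow> nat"
    and L q :: "nat \<Rightarrow> real"
    and A :: "nat \<Rightarrow> nat \<Rightarrow> 'a \<Rightarrow> real mat"
    and k :: nat and \<Lambda> :: "nat \<Rightarrow> real mat"
    and B :: "nat \<Rightarrow> real" and \<beta> :: real
  assumes "prob_space M"
    and "\<And>j. j \<in> {1..J} \<Longrightarrow> L j > 0"
    and "\<And>t j. j \<in> {1..J} \<Longrightarrow> random_mat M (m j) (n j) (A t j)"
    and "\<And>j. j \<in> {1..J} \<Longrightarrow> mat_expectation M (m j) (n j) (A 0 j) = 0\<^sub>m (m j) (n j)"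
    and "\<And>t j. t \<ge> 1 \<Longrightarrow> j \<in> {1..J} \<Longrightarrow>
           AE \<omega> in M. mat_cond_exp M (gen_sigma M J m n A (t - 1)) (m j) (n j) (A t j) \<omega>
                      = 0\<^sub>m (m j) (n j)"
    and "\<And>t j. j \<in> {1..J} \<Longrightarrow> mat_integrable M (m j) (m j) (\<lambda>\<omega>. A t j \<omega> * (A t j \<omega>)\<^sup>T)"
    and "k \<ge> 1"
    and "\<And>j. j \<in> {1..J} \<Longrightarrow> sym_pos_def (m j) (\<Lambda> j)"
    and "\<And>j. j \<in> {1..J} \<Longrightarrow> q j \<in> {1..2}"
    and "\<And>j. j \<in> {1..J} \<Longrightarrow> B j \<ge> 0"
    and "\<And>j. j \<in> {1..J} \<Longrightarrow>
           (B j)\<^sup>2 = inverse (L j)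
             * schatten_norm (if q j = 2 then \<infinity> else ereal (q j / (2 - q j))) (\<Lambda> j)
             * (\<Sum>t<k. mat_trace (mat_expectation M (m j) (m j) (\<lambda>\<omega>. A t j \<omega> * (A t j \<omega>)\<^sup>T)
                                  * mat_inv (\<Lambda> j)))"
    and "\<beta> \<in> {1..2}"
  shows "(\<integral>\<^sup>+ \<omega>. ennreal ((mixed_norm J \<beta> L q
             (\<lambda>j. mat_sum (m j) (n j) (\<lambda>t. A t j \<omega>) {..<k}))\<^sup>2) \<partial>M)
         \<le> ennreal ((lp_norm (ereal \<beta>) {1..J} B)\<^sup>2)"
proof -
  note L = assms(2) and A = assms(3) and cond = assms(5) and int = assms(6) and \<Lambda> = assms(8)
    and q = assms(9) and B = assms(10) and B_eq = assms(11) and \<beta> = assms(12)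
  define S where "S j \<omega> = mat_sum (m j) (n j) (\<lambda>t. A t j \<omega>) {..<k}" for j \<omega>
  define C where "C j = schatten_norm (if q j = 2 then \<infinity> else ereal (q j / (2 - q j))) (\<Lambda> j)" for j
  \<comment> \<open>This is the quadratic majorant of the scaled squared Schatten norm of block j;
    its mean is exactly B_j^2.\<close>
  define y where "y j \<omega> = inverse (L j) * C j * mat_trace (S j \<omega> * (S j \<omega>)\<^sup>T * mat_inv (\<Lambda> j))" for j \<omega>
  have S: "S j \<omega> \<in> carrier_mat (m j) (n j)" for j \<omega> by (simp add: S_def mat_sum_def)
  have W: "mat_inv (\<Lambda> j) \<in> carrier_mat (m j) (m j)" if j: "j \<in> {1..J}" for j
  proof -
    obtain V l where "V \<in> carrier_mat (m j) (m j)" "mat_inv (\<Lambda> j) = V * mat_diag (m j) (\<lambda>i. 1 / l i) * V\<^sup>T"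
      using sym_pos_def_diagonalization[OF \<Lambda>[OF j]] by metis
    then show ?thesis by (auto intro!: mult_carrier_mat[of _ "m j" "m j"])
  qed
  have meas: "(\<lambda>\<omega>. A t j \<omega> $$ (r, c)) \<in> borel_measurable M"
    if "j \<in> {1..J}" "r < m j" "c < n j" for t j r c
    using A[OF that(1), of t] that by (simp add: random_mat_def)
  have int2: "integrable M (\<lambda>\<omega>. A s j \<omega> $$ (r, c) * A t j \<omega> $$ (r', c))"
    if "j \<in> {1..J}" "r < m j" "r' < m j" "c < n j" for s t j r r' c
    using that by (intro integrable_mult_of_square meas integrable_square_entry[OF A int])
  have orth: "(\<integral>\<omega>. A s j \<omega> $$ (r, c) * A t j \<omega> $$ (r', c) \<partial>M) = 0"
    if st: "s \<noteq> t" and j: "j \<in> {1..J}" "r < m j" "r' < m j" "c < n j" for s t j r r' c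
  proof (cases "s < t")
    case True
    then show ?thesis
      using j by (intro martingale_difference_orthogonal[OF assms(1) A cond] int2) auto
  next
    case False
    \<comment> \<open>Conditioning always acts on the later factor, so the two factors exchange
      their roles.\<close>
    with st have "t < s" by simp
    then have "(\<integral>\<omega>. A t j \<omega> $$ (r', c) * A s j \<omega> $$ (r, c) \<partial>M) = 0"
      using j by (intro martingale_difference_orthogonal[OF assms(1) A cond] int2) auto
    then show ?thesis by (simp add: mult.commute)
  qed
  have trace: "integrable M (\<lambda>\<omega>. mat_trace (S j \<omega> * (S j \<omega>)\<^sup>T * mat_inv (\<Lambda> j)))"
    "(\<integral>\<omega>. mat_trace (S j \<omega> * (S j \<omega>)\<^sup>T * mat_inv (\<Lambda> j)) \<partial>M)
     = (\<Sum>t<k. mat_trace (mat_expectation M (m j) (m j) (\<lambda>\<omega>. A t j \<omega> * (A t j \<omega>)\<^sup>T) * mat_inv (\<Lambda> j)))"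
    if j: "j \<in> {1..J}" for j
    unfolding S_def by (rule integral_trace_mat_sum[OF A[OF j] W[OF j] int2[OF j] orth[OF _ j]]; assumption)+
  have "(\<integral>\<^sup>+ \<omega>. ennreal ((lp_norm (ereal \<beta>) {1..J}
            (\<lambda>j. L j powr (- 1 / 2) * schatten_norm (ereal (q j)) (S j \<omega>)))\<^sup>2) \<partial>M)
        \<le> ennreal ((lp_norm (ereal \<beta>) {1..J} B)\<^sup>2)"
  proof (rule nn_integral_lp_norm_square_le[OF _ \<beta>])
    fix j assume j: "j \<in> {1..J}"
    show "integrable M (y j)" unfolding y_def by (intro integrable_mult_right trace j)
    show "integral\<^sup>L M (y j) = (B j)\<^sup>2"
      unfolding y_def by (simp add: trace[OF j] B_eq[OF j] C_def)
    show "0 \<le> B j" by (rule B[OF j])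
    fix \<omega>
    show "0 \<le> L j powr (- 1 / 2) * schatten_norm (ereal (q j)) (S j \<omega>)"
      by (simp add: schatten_norm_nonneg)
    have "(L j powr (- 1 / 2))\<^sup>2 = inverse (L j)"
    proof -
      have "(L j powr (- 1 / 2))\<^sup>2 = L j powr (- 1 / 2 + - 1 / 2)"
        by (simp only: power2_eq_square powr_add)
      then show ?thesis using L[OF j] by (simp add: powr_minus)
    qed
    then have "(L j powr (- 1 / 2) * schatten_norm (ereal (q j)) (S j \<omega>))\<^sup>2
        = inverse (L j) * (schatten_norm (ereal (q j)) (S j \<omega>))\<^sup>2"
      by (simp add: power_mult_distrib)
    also have "\<dots> \<le> y j \<omega>"
      unfolding y_def C_def mult.assoc using L[OF j]
      by (intro mult_left_mono schatten_norm_square_le(1)[OF S \<Lambda>[OF j] q[OF j]]) auto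
    finally show "(L j powr (- 1 / 2) * schatten_norm (ereal (q j)) (S j \<omega>))\<^sup>2 \<le> y j \<omega>" .
  qed simp
  then show ?thesis by (simp add: mixed_norm_def S_def)
qed

end
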